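(* Let $\mathscr{D}$ be the set of planar link diagrams transverse to the axis $\{0\}\times\mathbb{R}$ and let $\langle\cdot\rangle\colon\mathscr{D}\to\mathbb{Z}(A,B)$ be the two-variable bracket. Then $\langle D\rangle$ is invariant under the regular Reidemeister moves respecting the axis, i.e. under the moves R2, R3 off the axis and the moves S2 (that is, S2v, S2h, S2$\pm$), S3, S4 on the axis. Moreover, R1-moves off the axis contribute a factor $-A^{\pm3}$ and S1-moves on the axis contribute a factor $-B^{\pm3}$: if $D$ is obtained from $D'$ by an R1-move inserting a kink of crossing sign $\pm1$ off the axis, then $\langle D\rangle=(-A^{\pm3})\langle D'\rangle$; if $D$ is obtained from $D'$ by an S1-move inserting a kink of crossing sign $\pm1$ on the axis, then $\langle D\rangle=(-B^{\pm3})\langle D'\rangle$.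
   Context: Diagrams: $\mathscr{D}$ is the set of unoriented planar link diagrams in $\mathbb{R}^2$ that are transverse to the axis $\{0\}\times\mathbb{R}$ (every strand meeting the axis does so transversally; crossings may lie on the axis). Diagrams are identified if they differ by an orientation-preserving diffeomorphism of $\mathbb{R}^2$ fixing the axis setwise. Crossings are thus either on or off the axis. Crossings on the axis: such a crossing has two ends on the left and two ends on the right. It is of type $X_o$ if the overstrand runs from upper left to lower right, of type $X_u$ if the overstrand runs from lower left to upper right. Its horizontal smoothing $h$ joins the upper left end to the upper right end and the lower left end to the lower right end (two strands crossing the axis); its vertical smoothing $v$ joins the two left ends to each other and the two right ends to each other (two strands not meeting the axis). Bracket: $\langle\cdot\rangle\colon\mathscr{D}\to\mathbb{Z}(A,B)$ (field of rational functions) is defined by: (A) for a crossing off the axis, Kauffman's relation $\langle D\rangle=A\langle D_A\rangle+A^{-1}\langle D_B\rangle$, where $D_A$ is the smoothing joining the two regions swept out when the overstrand is turned counterclockwise to the understrand, and $D_B$ is the other smoothing; (B) for a crossing on the axis, $\langle X_o\rangle=B\langle h\rangle+B^{-1}\langle v\rangle$ and $\langle X_u\rangle=B^{-1}\langle h\rangle+B\langle v\rangle$; (C) for a collection $C$ of $n$ disjoint circles without crossings meeting the axis in $2m$ points, $\langle C\rangle=(-A^2-A^{-2})^{n-m}(-B^2-B^{-2})^{m-1}$. Reidemeister moves respecting the axis: the usual moves R1, R2, R3 inside a disk disjoint from the axis, and the following moves (and their inverses) inside a disk crossed by the axis. S1: insert on a strand crossing the axis once a kink whose crossing lies on the axis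 and whose loop crosses the axis once more (an $X_o$ or $X_u$ whose two upper, or two lower, ends are joined by an arc crossing the axis once). S2v: two consecutive crossings on the axis of opposite types $X_o,X_u$ between the same two strands, stacked vertically, are replaced by two vertical strands, one left and one right of the axis. S2h: for arcs $y=x^2+c$ and $y=-x^2$, the same arc being over at both crossings, change $c<0$ into $c>0$. S2$\pm$: viewing two horizontally running strands as a 2-braid, replace three consecutive crossings $\sigma^{\varepsilon}\sigma^{\delta}\sigma^{-\varepsilon}$ ($\varepsilon,\delta\in\{\pm1\}$; the first crossing left of the axis, the middle one on the axis, the last one right of the axis) by the single crossing $\sigma^{\delta}$ on the axis. S3: for lines $y=\pm ax$ ($a>0$) crossing on the axis in a crossing of either type and a horizontal line $y=c$ passing over both or under both of them, change $c>0$ into $c<0$. S4: for lines $y=c\pm ax$ and $y=c'\pm bx$ ($a,b>0$, $a\neq b$), each pair forming a crossing on the axis of arbitrary type, and both lines of the first pair passing over both lines of the second pair, change $c>c'$ into $c<c'$ keeping the types of the crossings on the axis. *)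

theory Defs
  imports "HOL-Computational_Algebra.Computational_Algebra"
begin

text \<open>
  Diagrams transverse to the axis are encoded in Morse position with respect to the horizontal
  coordinate: the plane is scanned from left to right, and every vertical slice meets the diagram
  in strands numbered \<open>0, 1, 2, \<dots>\<close> from bottom to top.  One slice is the axis itself.  A diagram is
  thus a word of elementary pieces for the left half-plane, the list of strands and crossings
  lying on the axis from bottom to top, and a word for the right half-plane.  (Unoriented link
  diagrams are encoded by words of cups, caps and crossings in the same spirit in the AFP entry
  Knot_Theory.)  Every diagram can be brought into this position by an isotopy preserving the
  axis, and the words are then identified if they represent the same diagram up to diffeomorphism.
\<close>

text \<open>
  A crossing always has two ends on its left and two ends on its right.  In \<open>Xo\<close> the overstrand
  runs from upper left to lower right, in \<open>Xu\<close> from lower left to upper right; this is used both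
  on and off the axis.  Viewed as 2-braids, \<open>Xo\<close> and \<open>Xu\<close> are inverse to each other.
\<close>

datatype crossing = Xo | Xu

fun opp :: "crossing \<Rightarrow> crossing" where
  "opp Xo = Xu"
| "opp Xu = Xo"

text \<open>
  Pieces off the axis.  \<open>Birth i\<close> is an arc open to the right whose two ends become the strands
  \<open>i\<close> and \<open>i + 1\<close>; \<open>Death i\<close> is an arc open to the left which joins the strands \<open>i\<close> and \<open>i + 1\<close>;
  \<open>Cross c i\<close> is a crossing of the strands \<open>i\<close> and \<open>i + 1\<close>.
\<close>

datatype piece = Birth nat | Death nat | Cross crossing nat

fun pos :: "piece \<Rightarrow> nat" where
  "pos (Birth i) = i"
| "pos (Death i) = i"
| "pos (Cross c i) = i"

fun put :: "nat \<Rightarrow> piece \<Rightarrow> piece" where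
  "put j (Birth i) = Birth j"
| "put j (Death i) = Death j"
| "put j (Cross c i) = Cross c j"

fun ends_l :: "piece \<Rightarrow> nat" where
  "ends_l (Birth i) = 0"
| "ends_l (Death i) = 2"
| "ends_l (Cross c i) = 2"

fun ends_r :: "piece \<Rightarrow> nat" where
  "ends_r (Birth i) = 2"
| "ends_r (Death i) = 0"
| "ends_r (Cross c i) = 2"

definition after :: "nat \<Rightarrow> piece \<Rightarrow> nat" where
  "after n x = n - ends_l x + ends_r x"

text \<open>\<open>tangle w m n\<close>: the word \<open>w\<close> is meaningful on \<open>m\<close> incoming strands and has \<open>n\<close> outgoing
  strands.\<close>

fun tangle :: "piece list \<Rightarrow> nat \<Rightarrow> nat \<Rightarrow> bool" where
  "tangle [] m n = (m = n)"
| "tangle (x # w) m n = (pos x + ends_l x \<le> m \<and> tangle w (after m x) n)"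

text \<open>The axis is met by strands crossing it transversally (\<open>Thru\<close>) and by crossings lying on it.\<close>

datatype slot = Thru | OnAxis crossing

fun slot_width :: "slot \<Rightarrow> nat" where
  "slot_width Thru = 1"
| "slot_width (OnAxis c) = 2"

definition width :: "slot list \<Rightarrow> nat" where
  "width a = sum_list (map slot_width a)"

datatype word = Word "piece list" "slot list" "piece list"

fun valid :: "word \<Rightarrow> bool" where
  "valid (Word l a r) = (tangle l 0 (width a) \<and> tangle r (width a) 0)"

section \<open>Identification of words representing the same diagram\<close>

text \<open>
  Elementary planar isotopies in one of the two half-planes: two pieces exchange their horizontal
  order (here \<open>y\<close> lies above \<open>x\<close>); a pair of a birth and a death is created or cancelled on a
  strand; a strand crossing one leg of an arc is moved to the other leg past the turning point
  of the arc.  In the last case the strand that is over remains over, so that the type of the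
  crossing changes.
\<close>

inductive planar_move :: "piece list \<Rightarrow> piece list \<Rightarrow> bool" where
  exchange: "pos x + ends_r x \<le> pos y \<Longrightarrow>
     planar_move [x, y] [put (pos y - ends_r x + ends_l x) y, x]"
| zigzag_up: "planar_move [] [Birth i, Death (i + 1)]"
| zigzag_down: "planar_move [] [Birth (i + 1), Death i]"
| turn_birth: "planar_move [Birth i, Cross c (i + 1)] [Birth (i + 1), Cross (opp c) i]"
| turn_death: "planar_move [Cross c (i + 1), Death i] [Cross (opp c) i, Death (i + 1)]"

text \<open>
  Rotation of the plane by a half-turn, the only orientation preserving diffeomorphism fixing the
  axis setwise that is not isotopic to the identity through such diffeomorphisms.  A piece of a
  word acting on \<open>n\<close> strands is turned around; crossings keep their type.
\<close>

fun rot_piece :: "nat \<Rightarrow> piece \<Rightarrow> piece" where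
  "rot_piece n (Birth i) = Death (n - i)"
| "rot_piece n (Death i) = Birth (n - 2 - i)"
| "rot_piece n (Cross c i) = Cross c (n - 2 - i)"

fun rot_pieces :: "nat \<Rightarrow> piece list \<Rightarrow> piece list" where
  "rot_pieces n [] = []"
| "rot_pieces n (x # w) = rot_pieces (after n x) w @ [rot_piece n x]"

fun half_turn :: "word \<Rightarrow> word" where
  "half_turn (Word l a r) = Word (rot_pieces (width a) r) (rev a) (rot_pieces 0 l)"

inductive same_diagram :: "word \<Rightarrow> word \<Rightarrow> bool" where
  refl: "valid W \<Longrightarrow> same_diagram W W"
| sym: "same_diagram W W' \<Longrightarrow> same_diagram W' W"
| trans: "same_diagram W W' \<Longrightarrow> same_diagram W' W'' \<Longrightarrow> same_diagram W W''"
| left: "planar_move u u' \<Longrightarrow> valid (Word (p @ u @ q) a r) \<Longrightarrow> valid (Word (p @ u' @ q) a r) \<Longrightarrow>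
     same_diagram (Word (p @ u @ q) a r) (Word (p @ u' @ q) a r)"
| right: "planar_move u u' \<Longrightarrow> valid (Word l a (p @ u @ q)) \<Longrightarrow> valid (Word l a (p @ u' @ q)) \<Longrightarrow>
     same_diagram (Word l a (p @ u @ q)) (Word l a (p @ u' @ q))"
| turn: "valid W \<Longrightarrow> valid (half_turn W) \<Longrightarrow> same_diagram W (half_turn W)"

text \<open>The set of diagrams transverse to the axis is the type \<open>diagram\<close>; \<open>diag W\<close> is the diagram
  represented by the (valid) word \<open>W\<close>.\<close>

quotient_type diagram = word / partial: same_diagram
proof (rule part_equivpI)
  have "same_diagram (Word [] [] []) (Word [] [] [])"
    by (rule same_diagram.refl) (simp add: width_def)
  then show "\<exists>W. same_diagram W W" by blast
  show "symp same_diagram" by (rule sympI) (rule same_diagram.sym)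
  show "transp same_diagram" by (rule transpI) (rule same_diagram.trans)
qed

abbreviation diag :: "word \<Rightarrow> diagram" where
  "diag \<equiv> abs_diagram"

section \<open>The bracket\<close>

text \<open>The field \<open>\<int>(A,B)\<close>, as the field of fractions of \<open>\<int>[A][B]\<close>.\<close>

type_synonym ratfun = "int poly poly fract"

definition varA :: ratfun where
  "varA = Fract [: [:0, 1:] :] 1"

definition varB :: ratfun where
  "varB = Fract [:0, 1:] 1"

definition deltaA :: ratfun where
  "deltaA = - (varA ^ 2) - inverse (varA ^ 2)"

definition deltaB :: ratfun where
  "deltaB = - (varB ^ 2) - inverse (varB ^ 2)"

text \<open>
  Number of components of a word: the points of the diagram on the slices \<open>t = 0, 1, 2, \<dots>\<close>
  between consecutive pieces are the pairs \<open>(t, j)\<close>, and \<open>arcs\<close> relates points joined by an arc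
  between neighbouring slices.  An axis without crossings amounts to no piece at all, so the
  circles of \<open>Word l a r\<close> are those of \<open>l @ r\<close>.
\<close>

fun turning :: "nat \<Rightarrow> piece \<Rightarrow> ((nat \<times> nat) \<times> (nat \<times> nat)) set" where
  "turning t (Birth i) = {((t + 1, i), (t + 1, i + 1))}"
| "turning t (Death i) = {((t, i), (t, i + 1))}"
| "turning t (Cross c i) = {((t, i), (t + 1, i + 1)), ((t, i + 1), (t + 1, i))}"

definition straight :: "nat \<Rightarrow> nat \<Rightarrow> piece \<Rightarrow> ((nat \<times> nat) \<times> (nat \<times> nat)) set" where
  "straight t n x =
     {((t, j), (t + 1, j)) | j. j < pos x} \<union>
     {((t, j), (t + 1, j - ends_l x + ends_r x)) | j. pos x + ends_l x \<le> j \<and> j < n}"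

fun arcs :: "nat \<Rightarrow> nat \<Rightarrow> piece list \<Rightarrow> ((nat \<times> nat) \<times> (nat \<times> nat)) set" where
  "arcs t n [] = {}"
| "arcs t n (x # w) = turning t x \<union> straight t n x \<union> arcs (t + 1) (after n x) w"

fun points :: "nat \<Rightarrow> nat \<Rightarrow> piece list \<Rightarrow> (nat \<times> nat) set" where
  "points t n [] = {t} \<times> {..<n}"
| "points t n (x # w) = {t} \<times> {..<n} \<union> points (t + 1) (after n x) w"

definition circles :: "piece list \<Rightarrow> nat" where
  "circles w = card (points 0 0 w // (arcs 0 0 w \<union> converse (arcs 0 0 w))^*)"

definition no_crossing :: "piece list \<Rightarrow> bool" where
  "no_crossing w \<longleftrightarrow> (\<forall>c i. Cross c i \<notin> set w)"

text \<open>
  Smoothings off the axis.  For \<open>Xu\<close> the overstrand, turned counterclockwise to the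
  understrand, sweeps out the upper and the lower region; for \<open>Xo\<close> it sweeps out the left and
  the right region.
\<close>

definition horizontal :: "nat \<Rightarrow> piece list" where
  "horizontal i = []"

definition vertical :: "nat \<Rightarrow> piece list" where
  "vertical i = [Death i, Birth i]"

fun smooth_A :: "crossing \<Rightarrow> nat \<Rightarrow> piece list" where
  "smooth_A Xo i = horizontal i"
| "smooth_A Xu i = vertical i"

fun smooth_B :: "crossing \<Rightarrow> nat \<Rightarrow> piece list" where
  "smooth_B Xo i = vertical i"
| "smooth_B Xu i = horizontal i"

definition skein_off_axis :: "(diagram \<Rightarrow> ratfun) \<Rightarrow> bool" where
  "skein_off_axis f \<longleftrightarrow>
     (\<forall>p c i q a r. valid (Word (p @ [Cross c i] @ q) a r) \<longrightarrow>
        f (diag (Word (p @ [Cross c i] @ q) a r)) =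
          varA * f (diag (Word (p @ smooth_A c i @ q) a r)) +
          inverse varA * f (diag (Word (p @ smooth_B c i @ q) a r))) \<and>
     (\<forall>l a p c i q. valid (Word l a (p @ [Cross c i] @ q)) \<longrightarrow>
        f (diag (Word l a (p @ [Cross c i] @ q))) =
          varA * f (diag (Word l a (p @ smooth_A c i @ q))) +
          inverse varA * f (diag (Word l a (p @ smooth_B c i @ q))))"

definition smooth_h :: "piece list \<Rightarrow> slot list \<Rightarrow> slot list \<Rightarrow> piece list \<Rightarrow> word" where
  "smooth_h l lo hi r = Word l (lo @ [Thru, Thru] @ hi) r"

definition smooth_v :: "piece list \<Rightarrow> slot list \<Rightarrow> slot list \<Rightarrow> piece list \<Rightarrow> word" where
  "smooth_v l lo hi r = Word (l @ [Death (width lo)]) (lo @ hi) ([Birth (width lo)] @ r)"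

definition skein_on_axis :: "(diagram \<Rightarrow> ratfun) \<Rightarrow> bool" where
  "skein_on_axis f \<longleftrightarrow>
     (\<forall>l lo hi r. valid (Word l (lo @ [OnAxis Xo] @ hi) r) \<longrightarrow>
        f (diag (Word l (lo @ [OnAxis Xo] @ hi) r)) =
          varB * f (diag (smooth_h l lo hi r)) + inverse varB * f (diag (smooth_v l lo hi r))) \<and>
     (\<forall>l lo hi r. valid (Word l (lo @ [OnAxis Xu] @ hi) r) \<longrightarrow>
        f (diag (Word l (lo @ [OnAxis Xu] @ hi) r)) =
          inverse varB * f (diag (smooth_h l lo hi r)) + varB * f (diag (smooth_v l lo hi r)))"

definition circle_formula :: "(diagram \<Rightarrow> ratfun) \<Rightarrow> bool" where
  "circle_formula f \<longleftrightarrow>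
     (\<forall>l m r. valid (Word l (replicate (2 * m) Thru) r) \<and> no_crossing l \<and> no_crossing r \<longrightarrow>
        f (diag (Word l (replicate (2 * m) Thru) r)) =
          deltaA powi (int (circles (l @ r)) - int m) * deltaB powi (int m - 1))"

text \<open>The two skein relations reduce every diagram to diagrams without crossings, so that at most
  one function satisfies all three rules.\<close>

definition bracket :: "diagram \<Rightarrow> ratfun" where
  "bracket = (THE f. skein_off_axis f \<and> skein_on_axis f \<and> circle_formula f)"

section \<open>Reidemeister moves respecting the axis\<close>

text \<open>
  A move replaces the content of a disk.  After an isotopy the disk is a rectangle: off the axis
  its content is then a sequence of consecutive pieces, and the disk can be turned such that the
  strands taking part in the move run horizontally, the other positions being identified with
  this one by \<open>same_diagram\<close>; if the disk is crossed by the axis, its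
  content is a triple consisting of the last pieces on the left, some consecutive slots on the
  axis, and the first pieces on the right.
\<close>

inductive off_axis :: "(piece list \<Rightarrow> piece list \<Rightarrow> bool) \<Rightarrow> diagram \<Rightarrow> diagram \<Rightarrow> bool"
  for M where
  "M u u' \<Longrightarrow> valid (Word (p @ u @ q) a r) \<Longrightarrow> valid (Word (p @ u' @ q) a r) \<Longrightarrow>
     off_axis M (diag (Word (p @ u @ q) a r)) (diag (Word (p @ u' @ q) a r))"
| "M u u' \<Longrightarrow> valid (Word l a (p @ u @ q)) \<Longrightarrow> valid (Word l a (p @ u' @ q)) \<Longrightarrow>
     off_axis M (diag (Word l a (p @ u @ q))) (diag (Word l a (p @ u' @ q)))"

type_synonym patch = "piece list \<times> slot list \<times> piece list"

text \<open>\<open>M k\<close> describes the replacement when the lowest strand entering the disk has number \<open>k\<close>.\<close>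

inductive on_axis :: "(nat \<Rightarrow> patch \<Rightarrow> patch \<Rightarrow> bool) \<Rightarrow> diagram \<Rightarrow> diagram \<Rightarrow> bool"
  for M where
  "M (width lo) (u, s, v) (u', s', v') \<Longrightarrow>
     valid (Word (p @ u) (lo @ s @ hi) (v @ q)) \<Longrightarrow>
     valid (Word (p @ u') (lo @ s' @ hi) (v' @ q)) \<Longrightarrow>
     on_axis M (diag (Word (p @ u) (lo @ s @ hi) (v @ q)))
               (diag (Word (p @ u') (lo @ s' @ hi) (v' @ q)))"

text \<open>
  Sign of a crossing both of whose strands are traversed from left to right: it is \<open>1\<close> if the
  direction of the overstrand is turned counterclockwise to that of the understrand, and \<open>-1\<close>
  otherwise.
\<close>

fun over_dir :: "crossing \<Rightarrow> int \<times> int" where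
  "over_dir Xo = (1, -1)"
| "over_dir Xu = (1, 1)"

fun under_dir :: "crossing \<Rightarrow> int \<times> int" where
  "under_dir Xo = (1, 1)"
| "under_dir Xu = (1, -1)"

definition crossing_sign :: "crossing \<Rightarrow> int" where
  "crossing_sign c = sgn (fst (over_dir c) * snd (under_dir c) - snd (over_dir c) * fst (under_dir c))"

text \<open>
  In the kinks below, a strand enters from the left, passes the crossing, runs back to the left
  through a loop above or below the crossing, and passes the crossing a second time; both passages
  run from left to right.  The first argument is the crossing sign of the kink, and the kink is
  present in the second of the two tangles.
\<close>

inductive local_R1 :: "int \<Rightarrow> piece list \<Rightarrow> piece list \<Rightarrow> bool" where
  loop_above: "local_R1 (crossing_sign c) [] [Birth (i + 1), Cross c i, Death (i + 1)]"
| loop_below: "local_R1 (crossing_sign c) [] [Birth i, Cross c (i + 1), Death i]"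

inductive local_R2 :: "piece list \<Rightarrow> piece list \<Rightarrow> bool" where
  "local_R2 [Cross c i, Cross (opp c) i] []"

text \<open>
  Number the strands \<open>1, 2, 3\<close> from bottom to top on the left; \<open>c12\<close>, \<open>c13\<close> and \<open>c23\<close> are the
  types of their mutual crossings.  The assumption excludes the two cases in which the three
  strands lie cyclically above each other.
\<close>

inductive local_R3 :: "piece list \<Rightarrow> piece list \<Rightarrow> bool" where
  "\<not> (c12 = c23 \<and> c13 = opp c12) \<Longrightarrow>
   local_R3 [Cross c12 i, Cross c13 (i + 1), Cross c23 i]
            [Cross c23 (i + 1), Cross c13 i, Cross c12 (i + 1)]"

inductive local_S1 :: "int \<Rightarrow> nat \<Rightarrow> patch \<Rightarrow> patch \<Rightarrow> bool" where
  loop_above: "local_S1 (crossing_sign c) k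
     ([], [Thru], [])
     ([Birth (k + 1)], [OnAxis c, Thru], [Death (k + 1)])"
| loop_below: "local_S1 (crossing_sign c) k
     ([], [Thru], [])
     ([Birth k], [Thru, OnAxis c], [Death k])"

inductive local_S2v :: "nat \<Rightarrow> patch \<Rightarrow> patch \<Rightarrow> bool" where
  "local_S2v k
     ([Birth (k + 1)], [OnAxis c, OnAxis (opp c)], [Death (k + 1)])
     ([Death k], [], [Birth k])"

text \<open>For \<open>c < 0\<close> each of the two arcs is lower left on one side and upper left on the other;
  the same arc is over at both crossings iff these are of opposite types.\<close>

inductive local_S2h :: "nat \<Rightarrow> patch \<Rightarrow> patch \<Rightarrow> bool" where
  "local_S2h k
     ([Cross c k], [Thru, Thru], [Cross (opp c) k])
     ([], [Thru, Thru], [])"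

inductive local_S2pm :: "nat \<Rightarrow> patch \<Rightarrow> patch \<Rightarrow> bool" where
  "local_S2pm k
     ([Cross e k], [OnAxis d], [Cross (opp e) k])
     ([], [OnAxis d], [])"

text \<open>The horizontal line is over for \<open>e = Xu\<close> and under for \<open>e = Xo\<close>.\<close>

inductive local_S3 :: "nat \<Rightarrow> patch \<Rightarrow> patch \<Rightarrow> bool" where
  "local_S3 k
     ([Cross e (k + 1)], [OnAxis d, Thru], [Cross (opp e) (k + 1)])
     ([Cross (opp e) k], [Thru, OnAxis d], [Cross e k])"

text \<open>
  The lines \<open>y = c \<plusminus> a x\<close> cross on the axis in type \<open>s\<close> and pass over the lines \<open>y = c' \<plusminus> b x\<close>,
  which cross on the axis in type \<open>t\<close>.  The two rules treat \<open>a > b\<close> and \<open>a < b\<close>.  In each of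
  them the first patch is the one with \<open>c > c'\<close>.
\<close>

inductive local_S4 :: "nat \<Rightarrow> patch \<Rightarrow> patch \<Rightarrow> bool" where
  over_steep: "local_S4 k
     ([Cross Xu k, Cross Xu (k + 1)], [OnAxis t, OnAxis s], [Cross Xo (k + 1), Cross Xo k])
     ([Cross Xo (k + 2), Cross Xo (k + 1)], [OnAxis s, OnAxis t],
        [Cross Xu (k + 1), Cross Xu (k + 2)])"
| under_steep: "local_S4 k
     ([Cross Xu (k + 2), Cross Xu (k + 1)], [OnAxis t, OnAxis s],
        [Cross Xo (k + 1), Cross Xo (k + 2)])
     ([Cross Xo k, Cross Xo (k + 1)], [OnAxis s, OnAxis t], [Cross Xu (k + 1), Cross Xu k])"

definition move_R1 :: "int \<Rightarrow> diagram \<Rightarrow> diagram \<Rightarrow> bool" where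
  "move_R1 e = off_axis (local_R1 e)"

definition move_R2 :: "diagram \<Rightarrow> diagram \<Rightarrow> bool" where
  "move_R2 = off_axis local_R2"

definition move_R3 :: "diagram \<Rightarrow> diagram \<Rightarrow> bool" where
  "move_R3 = off_axis local_R3"

definition move_S1 :: "int \<Rightarrow> diagram \<Rightarrow> diagram \<Rightarrow> bool" where
  "move_S1 e = on_axis (local_S1 e)"

definition move_S2 :: "diagram \<Rightarrow> diagram \<Rightarrow> bool" where
  "move_S2 D D' \<longleftrightarrow> on_axis local_S2v D D' \<or> on_axis local_S2h D D' \<or> on_axis local_S2pm D D'"

definition move_S3 :: "diagram \<Rightarrow> diagram \<Rightarrow> bool" where
  "move_S3 = on_axis local_S3"

definition move_S4 :: "diagram \<Rightarrow> diagram \<Rightarrow> bool" where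
  "move_S4 = on_axis local_S4"

end

theory Submission
  imports Defs "HOL-Library.Stream"
begin

text \<open>
  The bracket is evaluated by a transfer-matrix (Temperley--Lieb) model: a slice of the diagram is
  a sequence of spins in a two-element set, and arcs, caps and crossings act on functions of these
  spins.  With cup weights \<open>-A\<^sup>2, 1\<close> and cap weights \<open>1, -A\<^sup>-\<^sup>2\<close> on opposite spins, zigzags cancel
  and a circle has the value \<open>-A\<^sup>2 - A\<^sup>-\<^sup>2\<close>, so that every planar isotopy and every Reidemeister move
  becomes an identity between operators in the Temperley--Lieb algebra.  A strand crossing the
  axis contributes a square root of \<open>\<rho> = (B\<^sup>2 + B\<^sup>-\<^sup>2) / (A\<^sup>2 + A\<^sup>-\<^sup>2)\<close>; then a crossing of type \<open>X\<^sub>o\<close> on the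
  axis acts as \<open>B\<close> times the identity plus \<open>B\<^sup>-\<^sup>1 \<rho>\<^sup>-\<^sup>1\<close> times a cap followed by a cup, and all
  moves S are again consequences of the Temperley--Lieb relations.

  That the model computes the bracket requires counting circles.  The same model with all weights
  equal to \<open>1\<close> on equal spins counts the labellings of the points of a diagram that are constant
  along its arcs, hence yields \<open>2\<close> to the number of circles; both models are evaluated by the same
  reduction of a crossingless diagram.  Invariance under the half-turn follows from the uniqueness
  of a function satisfying the rules, because the counting model is invariant under transposition
  and reversal.
\<close>

section \<open>Temperley--Lieb operators\<close>

text \<open>
  Spin states are infinite streams although a slice has finitely many strands: the operators are
  then total and their relations need no side conditions on the number of strands.
\<close>

primrec cup :: "(bool \<Rightarrow> bool \<Rightarrow> 'a::comm_ring_1) \<Rightarrow> nat \<Rightarrow> (bool stream \<Rightarrow> 'a) \<Rightarrow> bool stream \<Rightarrow> 'a" where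
  "cup c 0 f s = (\<Sum>x\<in>UNIV. \<Sum>y\<in>UNIV. c x y * f (x ## y ## s))"
| "cup c (Suc i) f s = cup c i (\<lambda>t. f (shd s ## t)) (stl s)"

primrec cap :: "(bool \<Rightarrow> bool \<Rightarrow> 'a::comm_ring_1) \<Rightarrow> nat \<Rightarrow> (bool stream \<Rightarrow> 'a) \<Rightarrow> bool stream \<Rightarrow> 'a" where
  "cap d 0 f s = d (shd s) (shd (stl s)) * f (stl (stl s))"
| "cap d (Suc i) f s = cap d i (\<lambda>t. f (shd s ## t)) (stl s)"

lemma cup_linear: "cup c i (\<lambda>s. x * f s + y * g s) = (\<lambda>s. x * cup c i f s + y * cup c i g s)"
  by (induction i arbitrary: f g) (auto simp: fun_eq_iff algebra_simps sum.distrib sum_distrib_left)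

lemma cap_linear: "cap d i (\<lambda>s. x * f s + y * g s) = (\<lambda>s. x * cap d i f s + y * cap d i g s)"
  by (induction i arbitrary: f g) (auto simp: fun_eq_iff algebra_simps)

lemma cup_add: "cup c i (\<lambda>s. f s + g s) = (\<lambda>s. cup c i f s + cup c i g s)"
  using cup_linear[of c i 1 f 1 g] by simp

lemma cap_add: "cap d i (\<lambda>s. f s + g s) = (\<lambda>s. cap d i f s + cap d i g s)"
  using cap_linear[of d i 1 f 1 g] by simp

lemma cup_scale: "cup c i (\<lambda>s. x * f s) = (\<lambda>s. x * cup c i f s)"
  using cup_linear[of c i x f 0 f] by simp

lemma cap_scale: "cap d i (\<lambda>s. x * f s) = (\<lambda>s. x * cap d i f s)"
  using cap_linear[of d i x f 0 f] by simp

text \<open>Stripping the lowest spin reduces this and the three exchange laws below to an arc at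
  the bottom. There the operator is a finite sum or a scalar factor, which passes through the other
  one by linearity.\<close>

lemma cup_cup_exchange: "i \<le> j \<Longrightarrow> cup c i (cup c' (j + 2) f) = cup c' j (cup c i f)"
proof (induction i arbitrary: j f)
  case 0
  then show ?case
    by (auto simp: fun_eq_iff UNIV_bool cup_add algebra_simps numeral_2_eq_2 cup_scale)
next
  case (Suc i)
  then obtain j' where "j = Suc j'" "i \<le> j'" by (cases j) auto
  with fun_cong[OF Suc.IH[of j' "\<lambda>t. f (_ ## t)"]] show ?case by (auto simp: fun_eq_iff)
qed

lemma cup_cap_exchange: "i \<le> j \<Longrightarrow> cup c i (cap d (j + 2) f) = cap d j (cup c i f)"
proof (induction i arbitrary: j f)
  case 0
  then show ?case
    by (auto simp: fun_eq_iff UNIV_bool cap_add algebra_simps numeral_2_eq_2 cap_scale)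
next
  case (Suc i)
  then obtain j' where "j = Suc j'" "i \<le> j'" by (cases j) auto
  with fun_cong[OF Suc.IH[of j' "\<lambda>t. f (_ ## t)"]] show ?case by (auto simp: fun_eq_iff)
qed

lemma cap_cup_exchange: "i \<le> j \<Longrightarrow> cap d i (cup c j f) = cup c (j + 2) (cap d i f)"
proof (induction i arbitrary: j f)
  case 0
  then show ?case
    by (auto simp: fun_eq_iff numeral_2_eq_2 cup_scale)
next
  case (Suc i)
  then obtain j' where "j = Suc j'" "i \<le> j'" by (cases j) auto
  with fun_cong[OF Suc.IH[of j' "\<lambda>t. f (_ ## t)"]] show ?case by (auto simp: fun_eq_iff)
qed

lemma cap_cap_exchange: "i \<le> j \<Longrightarrow> cap d i (cap d' j f) = cap d' (j + 2) (cap d i f)"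
proof (induction i arbitrary: j f)
  case 0
  then show ?case
    by (auto simp: fun_eq_iff numeral_2_eq_2 cap_scale)
next
  case (Suc i)
  then obtain j' where "j = Suc j'" "i \<le> j'" by (cases j) auto
  with fun_cong[OF Suc.IH[of j' "\<lambda>t. f (_ ## t)"]] show ?case by (auto simp: fun_eq_iff)
qed

lemma opp_opp [simp]: "opp (opp e) = e"
  by (cases e) auto

text \<open>The snake laws make \<open>c\<close> and \<open>d\<close> mutually inverse matrices. The
  weights stay abstract because two instances are compared below: one computes the bracket, the
  other counts labellings.\<close>

locale temperley_lieb =
  fixes c d :: "bool \<Rightarrow> bool \<Rightarrow> 'a::comm_ring_1" and \<delta> :: 'a
  assumes snake_up: "(\<Sum>y\<in>UNIV. c x y * d y z) = of_bool (x = z)"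
    and snake_down: "(\<Sum>y\<in>UNIV. d x y * c y z) = of_bool (x = z)"
    and loop: "(\<Sum>x\<in>UNIV. \<Sum>y\<in>UNIV. c x y * d x y) = \<delta>"
begin

lemma cup_cap_Suc: "cup c i (cap d (Suc i) f) = f"
proof (induction i arbitrary: f)
  case 0
  show ?case
  proof
    fix s
    have "cup c 0 (cap d (Suc 0) f) s =
      (\<Sum>x\<in>UNIV. (\<Sum>y\<in>UNIV. c x y * d y (shd s)) * f (x ## stl s))"
      by (simp add: sum_distrib_left sum_distrib_right mult_ac)
    also have "\<dots> = (\<Sum>x\<in>UNIV. of_bool (x = shd s) * f (x ## stl s))"
      by (simp only: snake_up)
    also have "\<dots> = f s"
      by (cases s; cases "shd s") (simp_all add: UNIV_bool)
    finally show "cup c 0 (cap d (Suc 0) f) s = f s" .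
  qed
next
  case (Suc i)
  with fun_cong[OF Suc.IH[of "\<lambda>t. f (_ ## t)"]] show ?case by (simp add: fun_eq_iff)
qed

lemma cup_Suc_cap: "cup c (Suc i) (cap d i f) = f"
proof (induction i arbitrary: f)
  case 0
  show ?case
  proof
    fix s
    have "cup c (Suc 0) (cap d 0 f) s =
      (\<Sum>y\<in>UNIV. (\<Sum>x\<in>UNIV. d (shd s) x * c x y) * f (y ## stl s))"
      by (cases s) (simp add: UNIV_bool algebra_simps)
    also have "\<dots> = (\<Sum>y\<in>UNIV. of_bool (shd s = y) * f (y ## stl s))"
      by (simp only: snake_down)
    also have "\<dots> = f s"
      by (cases s; cases "shd s") (simp_all add: UNIV_bool)
    finally show "cup c (Suc 0) (cap d 0 f) s = f s" .
  qed
next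
  case (Suc i)
  with fun_cong[OF Suc.IH[of "\<lambda>t. f (_ ## t)"]] show ?case by (simp add: fun_eq_iff)
qed

lemma cup_cap_same: "cup c i (cap d i f) = (\<lambda>s. \<delta> * f s)"
proof (induction i arbitrary: f)
  case 0
  show ?case
    by (auto simp: fun_eq_iff loop[symmetric] sum_distrib_left mult_ac)
next
  case (Suc i)
  with fun_cong[OF Suc.IH[of "\<lambda>t. f (_ ## t)"]] show ?case by (simp add: fun_eq_iff)
qed

declare cup.simps [simp del] cap.simps [simp del]

lemmas tl_simps = cup_cap_Suc cup_Suc_cap cup_cap_same
  cup_linear cap_linear cup_scale cap_scale cup_add cap_add

text \<open>With \<open>cap d i\<close> after \<open>cup c i\<close> as Temperley-Lieb generator,
  this is a crossing expanded into its horizontal smoothing (weight \<open>x\<close>) and its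
  vertical one (weight \<open>y\<close>). Free weights cover crossings off and on the axis
  alike.\<close>

definition braid :: "'a \<Rightarrow> 'a \<Rightarrow> nat \<Rightarrow> (bool stream \<Rightarrow> 'a) \<Rightarrow> bool stream \<Rightarrow> 'a" where
  "braid x y i f = (\<lambda>s. x * f s + y * cap d i (cup c i f) s)"

lemma cup_braid_exchange: "i \<le> j \<Longrightarrow> cup c i (braid x y (j + 2) f) = braid x y j (cup c i f)"
  unfolding braid_def cup_linear by (subst cup_cap_exchange, simp, subst cup_cup_exchange) simp_all

lemma cap_braid_exchange: "i \<le> j \<Longrightarrow> cap d i (braid x y j f) = braid x y (j + 2) (cap d i f)"
  unfolding braid_def cap_linear by (subst cap_cap_exchange, simp, subst cap_cup_exchange) simp_all

lemma braid_cup_exchange: "i + 2 \<le> j \<Longrightarrow> braid x y i (cup c j f) = cup c j (braid x y i f)"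
proof -
  assume "i + 2 \<le> j"
  then obtain k where k: "j = k + 2" "i \<le> k" using le_Suc_ex[of "i+2" j] by auto
  show ?thesis
    using k by (simp add: braid_def cup_linear cup_cup_exchange[simplified] cap_cup_exchange[simplified])
qed

lemma braid_cap_exchange: "i + 2 \<le> j \<Longrightarrow> braid x y i (cap d j f) = cap d j (braid x y i f)"
proof -
  assume "i + 2 \<le> j"
  then obtain k where k: "j = k + 2" "i \<le> k" using le_Suc_ex[of "i+2" j] by auto
  show ?thesis
    using k by (simp add: braid_def cap_linear cup_cap_exchange[simplified] cap_cap_exchange[simplified])
qed

lemma braid_linear:
  "braid u v i (\<lambda>s. x * f s + y * g s) = (\<lambda>s. x * braid u v i f s + y * braid u v i g s)"
  by (simp add: braid_def cup_linear cap_linear algebra_simps)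

lemma braid_braid_exchange: 
  "i + 2 \<le> j \<Longrightarrow> braid u v i (braid x y j f) = braid x y j (braid u v i f)"
  by (simp add: braid_def[of x y] braid_linear braid_cap_exchange braid_cup_exchange)

section \<open>Words of pieces and planar isotopy\<close>

primrec act :: "(crossing \<Rightarrow> 'a) \<Rightarrow> piece \<Rightarrow> (bool stream \<Rightarrow> 'a) \<Rightarrow> bool stream \<Rightarrow> 'a" where
  "act w (Birth i) = cup c i"
| "act w (Death i) = cap d i"
| "act w (Cross e i) = braid (w e) (w (opp e)) i"

text \<open>Functions of the spins on the right-hand slice are pulled back to the left-hand slice.
  This is why a birth, which adds two strands to the right, acts by summing over two spins.\<close>

primrec run :: "(crossing \<Rightarrow> 'a) \<Rightarrow> piece list \<Rightarrow> (bool stream \<Rightarrow> 'a) \<Rightarrow> bool stream \<Rightarrow> 'a" where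
  "run w [] f = f"
| "run w (x # u) f = act w x (run w u f)"

lemma run_append [simp]: "run w (u @ v) f = run w u (run w v f)"
  by (induction u) simp_all

lemma run_linear:
  "run w u (\<lambda>s. x * f s + y * g s) = (\<lambda>s. x * run w u f s + y * run w u g s)"
proof (induction u)
  case (Cons p u)
  then show ?case by (cases p) (simp_all add: cup_linear cap_linear braid_linear)
qed simp

lemma run_scale: "run w u (\<lambda>s. x * f s) = (\<lambda>s. x * run w u f s)"
  using run_linear[of w u x f 0 f] by simp

lemma braid_act_below:
  assumes "pos x + ends_l x \<le> j"
  shows "braid p q j (act w x f) = act w x (braid p q (j - ends_l x + ends_r x) f)"
proof -
  \<comment> \<open>The gap \<open>k\<close> turns the truncated subtraction in the shifted position
    into addition.\<close>
  obtain k where k: "j = pos x + ends_l x + k"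
    using assms le_Suc_ex by blast
  show ?thesis
  proof (cases x)
    case (Birth i)
    then show ?thesis
      using k cup_braid_exchange[of i "i + k" p q f] by (simp add: numeral_2_eq_2)
  next
    case (Death i)
    then show ?thesis
      using k cap_braid_exchange[of i "i + k" p q f] by (simp add: numeral_2_eq_2 add.commute)
  next
    case (Cross e i)
    then show ?thesis
      using k braid_braid_exchange[of i "i + 2 + k" _ _ p q f] by simp
  qed
qed

lemma braid_act_above:
  "j + 2 \<le> pos x \<Longrightarrow> braid p q j (act w x f) = act w x (braid p q j f)"
  by (cases x) (auto simp: braid_cup_exchange braid_cap_exchange intro: braid_braid_exchange)

lemma act_exchange:
  assumes "pos x + ends_r x \<le> pos y"
  shows "act w x (act w y f) = act w (put (pos y - ends_r x + ends_l x) y) (act w x f)"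
proof -
  obtain k where k: "pos y = pos x + ends_r x + k"
    using assms le_Suc_ex by blast
  show ?thesis
  proof (cases x)
    case (Birth i)
    then show ?thesis
      using k cup_cup_exchange[of i "i + k" c c f] cup_cap_exchange[of i "i + k" c d f]
        cup_braid_exchange[of i "i + k" _ _ f]
      by (cases y) (simp_all add: numeral_2_eq_2 add.commute)
  next
    case (Death i)
    then show ?thesis
      using k cap_cup_exchange[of i "i + k" d c f] cap_cap_exchange[of i "i + k" d d f]
        cap_braid_exchange[of i "i + k" _ _ f]
      by (cases y) (simp_all add: numeral_2_eq_2 add.commute)
  next
    case (Cross e i)
    then show ?thesis
      using k braid_act_above[of i y "w e" "w (opp e)" w f] by (cases y) simp_all
  qed
qed

lemma run_planar_move: "planar_move u u' \<Longrightarrow> run w u f = run w u' f"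
proof (induction rule: planar_move.induct)
  case (exchange x y)
  then show ?case using act_exchange by simp
next
  \<comment> \<open>After a snake, the vertical smoothing on one side is the horizontal one on the
    other. The weights agree because \<open>opp\<close> swaps the weights of the two
    smoothings.\<close>
  case (turn_birth i e)
  then show ?case unfolding run.simps act.simps Suc_eq_plus1[symmetric] braid_def tl_simps
    by (simp add: algebra_simps)
next
  case (turn_death e i)
  then show ?case unfolding run.simps act.simps Suc_eq_plus1[symmetric] braid_def tl_simps
    by (simp add: algebra_simps)
qed (simp_all add: cup_cap_Suc cup_Suc_cap)

section \<open>Strands and crossings on the axis\<close>

context
  fixes h v :: "crossing \<Rightarrow> 'a"
begin

text \<open>\<open>j\<close> is the number of the lowest strand met by the list. A
  \<open>Thru\<close> acts as the identity; its weight enters \<open>state_sum\<close> through a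
  global power of \<open>rho\<close>.\<close>

fun axis :: "nat \<Rightarrow> slot list \<Rightarrow> (bool stream \<Rightarrow> 'a) \<Rightarrow> bool stream \<Rightarrow> 'a" where
  "axis j [] f = f"
| "axis j (Thru # a) f = axis (j + 1) a f"
| "axis j (OnAxis e # a) f = braid (h e) (v e) j (axis (j + 2) a f)"

lemma axis_append: "axis j (a @ b) f = axis j a (axis (j + width a) b f)"
proof (induction a arbitrary: j)
  case (Cons t a)
  then show ?case by (cases t) (simp_all add: width_def add.assoc)
qed (simp add: width_def)

lemma axis_linear:
  "axis j a (\<lambda>s. x * f s + y * g s) = (\<lambda>s. x * axis j a f s + y * axis j a g s)"
proof (induction a arbitrary: j)
  case (Cons t a)
  then show ?case by (cases t) (simp_all add: braid_linear)
qed simp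

lemma axis_scale: "axis j a (\<lambda>s. x * f s) = (\<lambda>s. x * axis j a f s)"
  using axis_linear[of j a x f 0 f] by simp

lemma axis_act_below:
  "pos x + ends_l x \<le> j \<Longrightarrow>
   axis j a (act w x f) = act w x (axis (j - ends_l x + ends_r x) a f)"
proof (induction a arbitrary: j)
  case (Cons t a)
  have "j + k - ends_l x + ends_r x = j - ends_l x + ends_r x + k" for k
    using Cons.prems by simp
  with Cons show ?case
    by (cases t) (simp_all add: braid_act_below del: add_2_eq_Suc' One_nat_def add_Suc_right)
qed simp

lemma axis_act_above:
  "j + width a \<le> pos x \<Longrightarrow> act w x (axis j a f) = axis j a (act w x f)"
proof (induction a arbitrary: j)
  case (Cons t a)
  then show ?case
    by (cases t) (simp_all add: width_def braid_act_above[symmetric])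
qed simp

end

end

section \<open>Reidemeister moves as operator identities\<close>

text \<open>These equations make opposite crossings cancel: in their product the identity has
  coefficient \<open>w e * w (opp e)\<close>, and once this is 1 the generator has coefficient
  \<open>(w e)\<^sup>2 + (w (opp e))\<^sup>2 + \<delta>\<close>.\<close>

locale kauffman = temperley_lieb +
  fixes w :: "crossing \<Rightarrow> 'a"
  assumes w_opp: "w e * w (opp e) = 1"
    and loop_value: "\<delta> = - (w e)\<^sup>2 - (w (opp e))\<^sup>2"
begin

abbreviation X :: "crossing \<Rightarrow> nat \<Rightarrow> (bool stream \<Rightarrow> 'a) \<Rightarrow> bool stream \<Rightarrow> 'a" where
  "X e \<equiv> braid (w e) (w (opp e))"

lemma w_cancel: "w e * (w (opp e) * z) = z" "w (opp e) * (w e * z) = z" "w (opp e) * w e = 1"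
  using w_opp[of e] by (metis mult.assoc mult_1_left, metis mult.assoc mult.commute mult_1_left,
      metis mult.commute)

lemma R2: "X e i (X (opp e) i f) = f"
proof -
  have "w e * (w e * z) + w (opp e) * (w (opp e) * z) + \<delta> * z = 0" for z
    by (simp add: loop_value[of e] power2_eq_square algebra_simps)
  from this[of "cap d i (cup c i f) _"] show ?thesis
    unfolding braid_def tl_simps by (simp add: fun_eq_iff w_cancel w_opp algebra_simps)
qed

lemma R2': "X (opp e) i (X e i f) = f"
  using R2[of "opp e"] by simp

lemmas R2_simps = R2[simplified opp_opp] R2'[simplified opp_opp]

text \<open>By linearity the sliding crossing may be replaced by a generator. Writing
  \<open>E_i\<close> for the generator at \<open>i\<close>, both sides then become
  \<open>E_(i+1) E_i\<close>, the remaining terms cancelling by the value of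
  \<open>\<delta>\<close>. As \<open>x\<close> and \<open>y\<close> are arbitrary, the sliding
  crossing may lie on the axis.\<close>

lemma slide_up:
  "X e i (X e (Suc i) (braid x y i f)) = braid x y (Suc i) (X e i (X e (Suc i) f))"
  unfolding braid_def tl_simps
  by (simp add: fun_eq_iff w_cancel w_opp algebra_simps loop_value[of e] power2_eq_square)

lemma slide_down:
  "braid x y i (X e (Suc i) (X e i f)) = X e (Suc i) (X e i (braid x y (Suc i) f))"
  unfolding braid_def tl_simps
  by (simp add: fun_eq_iff w_cancel w_opp algebra_simps loop_value[of e] power2_eq_square)

text \<open>The horizontal smoothing splits off a circle, the vertical one leaves two snakes. Free
  weights let the same computation serve R1 and S1.\<close>

lemma kink_up: "cup c (Suc i) (braid x y i (cap d (Suc i) f)) = (\<lambda>s. (x * \<delta> + y) * f s)"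
  unfolding braid_def tl_simps by (simp add: algebra_simps)

lemma kink_down: "cup c i (braid x y (Suc i) (cap d i f)) = (\<lambda>s. (x * \<delta> + y) * f s)"
  unfolding braid_def tl_simps by (simp add: algebra_simps)

text \<open>A crossing passes a strand lying over or under both of its strands. With on-axis weights
  for \<open>x\<close> and \<open>y\<close> this is the operator form of S3.\<close>

lemma conjugate_slide:
  "X e (Suc i) (braid x y i (X (opp e) (Suc i) f)) = X (opp e) i (braid x y (Suc i) (X e i f))"
proof -
  have "braid x y (Suc i) (X e i f)
      = braid x y (Suc i) (X e i (X e (Suc i) (X (opp e) (Suc i) f)))"
    by (simp add: R2_simps)
  also have "\<dots> = X e i (X e (Suc i) (braid x y i (X (opp e) (Suc i) f)))"
    by (simp add: slide_up)
  finally show ?thesis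
    by (simp add: R2_simps)
qed

lemma R3:
  assumes "\<not> (c12 = c23 \<and> c13 = opp c12)"
  shows "X c12 i (X c13 (Suc i) (X c23 i f)) = X c23 (Suc i) (X c13 i (X c12 (Suc i) f))"
proof -
  \<comment> \<open>In the acyclic cases strand 1 or strand 3 lies over or under both other strands,
    and the crossing of those two slides past it.\<close>
  consider "c12 = c13" | "c13 = c23"
    using assms by (cases c12; cases c13; cases c23) auto
  then show ?thesis
    by cases (simp_all add: slide_up slide_down)
qed

text \<open>The move S4; read from right to left for the opposite type it is the second case of the move.\<close>

lemma double_slide:
  "X e i (X e (Suc i) (braid x y i (braid u v (i + 2) (X (opp e) (Suc i) (X (opp e) i f))))) =
   X (opp e) (i + 2) (X (opp e) (Suc i) (braid u v i (braid x y (i + 2) (X e (Suc i) (X e (i + 2) f)))))"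
proof -
  \<comment> \<open>The crossing with weights \<open>u\<close>, \<open>v\<close> descends from
    \<open>i + 2\<close> to \<open>i\<close> by two conjugate slides, while the one with weights
    \<open>x\<close>, \<open>y\<close> climbs from \<open>i\<close> to \<open>i + 2\<close>; both
    pass through position \<open>i + 1\<close>.\<close>
  have "X e i (X e (Suc i) (braid x y i (braid u v (i + 2) (X (opp e) (Suc i) (X (opp e) i f))))) =
    braid x y (Suc i) (X e i (X e (Suc i) (braid u v (Suc (Suc i)) (X (opp e) (Suc i) (X (opp e) i f)))))"
    by (simp add: slide_up)
  also have "\<dots> = braid x y (Suc i) (X e i (X (opp e) (i + 2) (braid u v (Suc i) (X e (i + 2) (X (opp e) i f)))))"
    using conjugate_slide[of "opp e" "Suc i" u v] by simp
  also have "\<dots> = braid x y (Suc i) (X (opp e) (i + 2) (X e i (braid u v (Suc i) (X (opp e) i (X e (i + 2) f)))))"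
    by (simp only: braid_braid_exchange[OF order.refl])
  also have "\<dots> = braid x y (Suc i) (X (opp e) (Suc (Suc i)) (X (opp e) (Suc i) (braid u v i (X e (Suc i) (X e (i + 2) f)))))"
    using conjugate_slide[of "opp e" i u v] by simp
  also have "\<dots> = X (opp e) (i + 2) (X (opp e) (Suc i) (braid x y (i + 2) (braid u v i (X e (Suc i) (X e (i + 2) f)))))"
    using slide_down[of x y "Suc i" "opp e"] by simp
  finally show ?thesis
    by (simp only: braid_braid_exchange[OF order.refl])
qed

end

section \<open>Counting circles\<close>

lemma stream_eqI: "(\<And>j. s !! j = t !! j) \<Longrightarrow> s = t"
  by (coinduction arbitrary: s t) (metis snth.simps)

definition insert_two :: "nat \<Rightarrow> 'a \<Rightarrow> 'a \<Rightarrow> 'a stream \<Rightarrow> 'a stream" where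
  "insert_two i x y s = stake i s @- x ## y ## sdrop i s"

definition delete_two :: "nat \<Rightarrow> 'a stream \<Rightarrow> 'a stream" where
  "delete_two i s = stake i s @- sdrop (i + 2) s"

definition reverse_prefix :: "nat \<Rightarrow> 'a stream \<Rightarrow> 'a stream" where
  "reverse_prefix n s = rev (stake n s) @- sdrop n s"

lemma snth_insert_two:
  "insert_two i x y s !! j =
     (if j < i then s !! j else if j = i then x else if j = i + 1 then y else s !! (j - 2))"
proof -
  have "j < i \<or> j = i \<or> j = i + 1 \<or> i + 2 \<le> j" by linarith
  then consider "j < i" | "j = i" | "j = i + 1" | k where "j = i + 2 + k"
    by (auto simp: le_iff_add)
  then show ?thesis
    by cases (simp_all add: insert_two_def shift_snth sdrop_snth snth_Stream add.commute del: snth.simps(2))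
qed

lemma snth_delete_two: "delete_two i s !! j = (if j < i then s !! j else s !! (j + 2))"
  by (simp add: delete_two_def shift_snth sdrop_snth)

lemma snth_reverse_prefix:
  "reverse_prefix n s !! j = (if j < n then s !! (n - 1 - j) else s !! j)"
  by (simp add: reverse_prefix_def shift_snth sdrop_snth rev_nth)

lemma cup_eq: "cup c i f s = (\<Sum>x\<in>UNIV. \<Sum>y\<in>UNIV. c x y * f (insert_two i x y s))"
  by (induction i arbitrary: f s) (simp_all add: insert_two_def cup.simps)

lemma cap_eq: "cap d i f s = d (s !! i) (s !! (i + 1)) * f (delete_two i s)"
  by (induction i arbitrary: f s) (simp_all add: delete_two_def cap.simps numeral_2_eq_2)

section \<open>Labellings constant along arcs\<close>

definition labellings :: "'a set \<Rightarrow> ('a \<times> 'a) set \<Rightarrow> ('a \<Rightarrow> bool) set" where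
  "labellings P R = {f \<in> P \<rightarrow>\<^sub>E UNIV. \<forall>(x, y) \<in> R. f x = f y}"

text \<open>A labelling amounts to a function on the classes of points of \<open>P\<close>. Since
  \<open>R\<close> stays inside \<open>P\<close>, no chain starting in \<open>P\<close> leaves
  it.\<close>

lemma card_labellings:
  assumes "finite P" and R: "R \<subseteq> P \<times> P"
  shows "card (labellings P R) = 2 ^ card (P // (R \<union> R\<inverse>)\<^sup>*)"
proof -
  define E where "E = (R \<union> R\<inverse>)\<^sup>*"
  have E: "equiv UNIV E"
    unfolding E_def by (intro equivI) (auto simp: refl_rtrancl trans_rtrancl sym_rtrancl sym_Un_converse)
  have RE: "R \<subseteq> E" by (auto simp: E_def)
  have const: "y \<in> P \<and> f y = f x" if "(x, y) \<in> E" "x \<in> P" "f \<in> labellings P R" for f x y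
    using that(1) unfolding E_def
  proof (induction rule: rtrancl_induct)
    case (step y z)
    then show ?case using R that(3) by (auto simp: labellings_def)
  qed (use that in auto)
  define \<Phi> where "\<Phi> g = (\<lambda>x\<in>P. g (E `` {x}))" for g :: "'a set \<Rightarrow> bool"
  have "bij_betw \<Phi> (P // E \<rightarrow>\<^sub>E UNIV) (labellings P R)"
  proof (rule bij_betwI')
    fix g g' :: "'a set \<Rightarrow> bool"
    assume g: "g \<in> P // E \<rightarrow>\<^sub>E UNIV" "g' \<in> P // E \<rightarrow>\<^sub>E UNIV"
    show "(\<Phi> g = \<Phi> g') = (g = g')"
    proof
      assume eq: "\<Phi> g = \<Phi> g'"
      show "g = g'"
      proof (rule PiE_ext[OF g])
        fix C assume "C \<in> P // E"
        then obtain x where "x \<in> P" "C = E `` {x}" by (auto elim: quotientE)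
        then show "g C = g' C" using fun_cong[OF eq, of x] by (simp add: \<Phi>_def)
      qed
    qed simp
  next
    fix g :: "'a set \<Rightarrow> bool"
    have "\<Phi> g x = \<Phi> g y" if "(x, y) \<in> R" for x y
    proof -
      have "E `` {x} = E `` {y}"
        using that RE by (intro equiv_class_eq[OF E]) auto
      with that R show ?thesis by (auto simp: \<Phi>_def simp del: Image_singleton_iff)
    qed
    then show "\<Phi> g \<in> labellings P R"
      by (auto simp: labellings_def) (simp_all add: \<Phi>_def)
  next
    fix f assume f: "f \<in> labellings P R"
    \<comment> \<open>Any representative of a class gives the same value, by
      \<open>const\<close>.\<close>
    define g where "g = (\<lambda>C\<in>P // E. f (SOME z. z \<in> C))"
    have "\<Phi> g x = f x" for x
    proof (cases "x \<in> P")
      case True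
      have "x \<in> E `` {x}" by (rule equiv_class_self[OF E]) simp
      then have "(SOME z. z \<in> E `` {x}) \<in> E `` {x}" by (rule someI)
      then have "f (SOME z. z \<in> E `` {x}) = f x"
        using const[OF _ True f] by blast
      with True show ?thesis
        by (simp add: \<Phi>_def g_def quotientI del: Image_singleton_iff)
    next
      case False
      with f show ?thesis by (auto simp: \<Phi>_def labellings_def PiE_def extensional_def)
    qed
    then have "f = \<Phi> g" by auto
    moreover have "g \<in> P // E \<rightarrow>\<^sub>E UNIV" by (auto simp: g_def)
    ultimately show "\<exists>g \<in> P // E \<rightarrow>\<^sub>E UNIV. f = \<Phi> g" by blast
  qed
  then have "card (labellings P R) = card (P // E \<rightarrow>\<^sub>E (UNIV :: bool set))"
    by (simp add: bij_betw_same_card)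
  also have "finite (P // E)"
    using \<open>finite P\<close> by (simp add: quotient_def)
  then have "card (P // E \<rightarrow>\<^sub>E (UNIV :: bool set)) = 2 ^ card (P // E)"
    by (simp add: card_funcsetE)
  finally show ?thesis by (simp add: E_def)
qed

lemma finite_points: "finite (points t n u)"
  by (induction u arbitrary: t n) auto

lemma fst_points: "p \<in> points t n u \<Longrightarrow> t \<le> fst p"
  by (induction u arbitrary: t n) force+

lemma points_first_row [simp]: "(t, j) \<in> points t n u \<longleftrightarrow> j < n"
  using fst_points[of "(t, j)" "t + 1"] by (cases u) force+

lemma arcs_points: "tangle u n m \<Longrightarrow> arcs t n u \<subseteq> points t n u \<times> points t n u"
proof (induction u arbitrary: t n)
  case (Cons x u)
  then have x: "pos x + ends_l x \<le> n" and u: "tangle u (after n x) m" by auto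
  have "turning t x \<union> straight t n x \<subseteq> points t n (x # u) \<times> points t n (x # u)"
    using x by (cases x) (auto simp: straight_def after_def)
  moreover have "arcs (t + 1) (after n x) u \<subseteq> points t n (x # u) \<times> points t n (x # u)"
    using Cons.IH[OF u, of "t + 1"] by auto
  ultimately show ?case by simp
qed simp

text \<open>Cups and caps become identity matrices: an arc forces equal labels at its ends, and a
  circle has 2 labellings.\<close>

interpretation counting: temperley_lieb "\<lambda>x y. of_bool (x = y)" "\<lambda>x y. of_bool (x = y)" "2 :: int"
  by unfold_locales (auto simp: UNIV_bool)

abbreviation count :: "piece list \<Rightarrow> (bool stream \<Rightarrow> int) \<Rightarrow> bool stream \<Rightarrow> int" where
  "count \<equiv> counting.run (\<lambda>_. 0)"

text \<open>Prescribing the first slice makes the number of labellings a function of a spin state,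
  so that it can satisfy the recursion of \<open>count\<close>.\<close>

definition row_labellings :: "nat \<Rightarrow> nat \<Rightarrow> bool stream \<Rightarrow> piece list \<Rightarrow> (nat \<times> nat \<Rightarrow> bool) set" where
  "row_labellings t n s u =
     {f \<in> labellings (points t n u) (arcs t n u). \<forall>j<n. f (t, j) = s !! j}"

text \<open>Outside the points of the row, the value is \<open>undefined\<close> to match the functions in \<open>labellings\<close>.\<close>

definition add_row :: "nat \<Rightarrow> nat \<Rightarrow> bool stream \<Rightarrow> (nat \<times> nat \<Rightarrow> bool) \<Rightarrow> nat \<times> nat \<Rightarrow> bool" where
  "add_row t n s g p = (if fst p = t then if snd p < n then s !! snd p else undefined else g p)"

text \<open>The first slice is determined by \<open>s\<close>. What remains is a labelling of the
  later slices, restricted by their own arcs and by those of \<open>x\<close>.\<close>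

lemma row_labellings_Cons:
  assumes "tangle (x # u) n m"
  shows "bij_betw (add_row t n s)
    {g \<in> labellings (points (t + 1) (after n x) u) (arcs (t + 1) (after n x) u).
      \<forall>(p, q) \<in> turning t x \<union> straight t n x. add_row t n s g p = add_row t n s g q}
    (row_labellings t n s (x # u))" (is "bij_betw _ ?M _")
proof -
  let ?P = "points (t + 1) (after n x) u" and ?R = "arcs (t + 1) (after n x) u"
  have R: "?R \<subseteq> ?P \<times> ?P" using assms by (auto intro!: arcs_points)
  have P: "fst p \<noteq> t" if "p \<in> ?P" for p using fst_points[OF that] by simp
  show ?thesis
  proof (rule bij_betwI')
    fix g g' assume g: "g \<in> ?M" "g' \<in> ?M"
    have "g p = g' p" if "add_row t n s g = add_row t n s g'" for p
    proof (cases "p \<in> ?P")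
      case True
      then show ?thesis using fun_cong[OF that, of p] P by (simp add: add_row_def)
    next
      case False
      then show ?thesis using g by (cases p) (auto simp: labellings_def PiE_def extensional_def)
    qed
    then show "(add_row t n s g = add_row t n s g') = (g = g')" by auto
  next
    fix g assume g: "g \<in> ?M"
    have "add_row t n s g p = add_row t n s g q" if "(p, q) \<in> ?R" for p q
    proof -
      have "p \<in> ?P" "q \<in> ?P" using R that by auto
      then show ?thesis using g that P[of p] P[of q] by (auto simp: add_row_def labellings_def)
    qed
    moreover have "add_row t n s g p = add_row t n s g q"
      if "(p, q) \<in> turning t x \<union> straight t n x" for p q
      using g that by blast
    ultimately have "add_row t n s g p = add_row t n s g q" if "(p, q) \<in> arcs t n (x # u)" for p q
      using that unfolding arcs.simps by blast
    moreover have "add_row t n s g p = undefined" if "p \<notin> points t n (x # u)" for p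
      using g that by (cases p) (auto simp: add_row_def labellings_def PiE_def extensional_def)
    moreover have "\<forall>j<n. add_row t n s g (t, j) = s !! j"
      by (simp add: add_row_def)
    ultimately show "add_row t n s g \<in> row_labellings t n s (x # u)"
      by (auto simp: row_labellings_def labellings_def PiE_def extensional_def simp del: arcs.simps points.simps)
  next
    fix f assume f: "f \<in> row_labellings t n s (x # u)"
    let ?g = "restrict f ?P"
    have fp: "f p = undefined" if "p \<notin> points t n (x # u)" for p
      using f that unfolding row_labellings_def labellings_def PiE_def extensional_def by blast
    have eq: "add_row t n s ?g = f"
    proof
      fix p
      show "add_row t n s ?g p = f p"
      proof (cases "fst p = t")
        case True
        then show ?thesis using f fp[of p]
          by (cases p) (auto simp: add_row_def row_labellings_def simp del: points.simps)
      next
        case False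
        then show ?thesis using fp[of p] by (cases p) (auto simp: add_row_def)
      qed
    qed
    have fR: "f p = f q" if "(p, q) \<in> arcs t n (x # u)" for p q
      using f that unfolding row_labellings_def labellings_def by blast
    have "?g p = ?g q" if "(p, q) \<in> ?R" for p q
      using fR[of p q] R that by auto
    then have "?g \<in> labellings ?P ?R"
      by (auto simp: labellings_def)
    moreover have "f p = f q" if "(p, q) \<in> turning t x \<union> straight t n x" for p q
      using fR[of p q] that by auto
    ultimately have "?g \<in> ?M" unfolding mem_Collect_eq eq by blast
    then show "\<exists>g \<in> ?M. f = add_row t n s g"
      by (rule bexI[where x = ?g, rotated]) (rule eq[symmetric])
  qed
qed

text \<open>Matches the sum in \<open>cup\<close>: the new arc carries one free label
  \<open>b\<close> at both ends.\<close>

lemma Birth_row_compatible: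
  assumes "i \<le> n"
  shows "(\<forall>(p, q) \<in> turning t (Birth i) \<union> straight t n (Birth i).
      add_row t n s g p = add_row t n s g q) \<longleftrightarrow>
    (\<exists>b. \<forall>j<n + 2. g (t + 1, j) = insert_two i b b s !! j)" (is "?L = ?R")
proof
  assume ?L
  then have L: "add_row t n s g p = add_row t n s g q"
    if "(p, q) \<in> turning t (Birth i) \<union> straight t n (Birth i)" for p q
    using that by blast
  have "g (t + 1, j) = insert_two i (g (t + 1, i)) (g (t + 1, i)) s !! j" if "j < n + 2" for j
  proof -
    have "j < i \<or> j = i \<or> j = i + 1 \<or> i + 2 \<le> j" by linarith
    then consider "j < i" | "j = i" | "j = i + 1" | k where "j = i + 2 + k"
      by (auto simp: le_iff_add)
    then show ?thesis
    proof cases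
      case 1
      then have "((t, j), (t + 1, j)) \<in> straight t n (Birth i)" by (auto simp: straight_def)
      from L[OF UnI2, OF this] 1 assms
      show ?thesis by (auto simp del: snth.simps simp: add_row_def snth_insert_two)
    next
      case 4
      then have "((t, i + k), (t + 1, j)) \<in> straight t n (Birth i)"
        using that by (auto simp: straight_def)
      from L[OF UnI2, OF this] 4 assms that
      show ?thesis by (auto simp del: snth.simps simp: add_row_def snth_insert_two)
    qed (use L[of "(t + 1, i)" "(t + 1, i + 1)"] in \<open>auto simp: add_row_def snth_insert_two simp del: snth.simps\<close>)
  qed
  then show ?R by blast
next
  assume ?R
  then obtain b where "g (t + 1, j) = insert_two i b b s !! j" if "j < n + 2" for j by blast
  with assms show ?L by (auto simp: add_row_def snth_insert_two straight_def)
qed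

text \<open>Matches the factor in \<open>cap\<close>: the closing arc imposes one equation on
  \<open>s\<close>, and the next row is determined.\<close>

lemma Death_row_compatible:
  assumes "i + 2 \<le> n"
  shows "(\<forall>(p, q) \<in> turning t (Death i) \<union> straight t n (Death i).
      add_row t n s g p = add_row t n s g q) \<longleftrightarrow>
    s !! i = s !! (i + 1) \<and> (\<forall>j<n - 2. g (t + 1, j) = delete_two i s !! j)" (is "?L = ?R")
proof
  assume ?L
  then have L: "add_row t n s g p = add_row t n s g q"
    if "(p, q) \<in> turning t (Death i) \<union> straight t n (Death i)" for p q
    using that by blast
  have "g (t + 1, j) = delete_two i s !! j" if "j < n - 2" for j
  proof (cases "j < i")
    case True
    then have "((t, j), (t + 1, j)) \<in> straight t n (Death i)" by (auto simp: straight_def)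
    from L[OF UnI2, OF this] True assms
      show ?thesis by (auto simp del: snth.simps simp: add_row_def snth_delete_two)
  next
    case False
    then have "((t, j + 2), (t + 1, j)) \<in> straight t n (Death i)"
      using that by (auto simp: straight_def intro!: exI[of _ "j + 2"])
    from L[OF UnI2, OF this] False that less_diff_conv[of j n 2]
      show ?thesis by (auto simp del: snth.simps simp: add_row_def snth_delete_two)
  qed
  moreover have "s !! i = s !! (i + 1)"
    using L[of "(t, i)" "(t, i + 1)"] assms by (simp add: add_row_def)
  ultimately show ?R by blast
next
  assume ?R
  moreover have "\<exists>k. j = k + 2" if "i + 2 \<le> j" for j
    using that by (intro exI[of _ "j - 2"]) simp
  ultimately show ?L using assms by (fastforce simp: add_row_def snth_delete_two straight_def)
qed

lemma finite_row_labellings: "finite (row_labellings t n s u)"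
  by (rule finite_subset[of _ "points t n u \<rightarrow>\<^sub>E UNIV"])
    (auto simp: row_labellings_def labellings_def finite_points intro!: finite_PiE)

lemma card_row_labellings:
  assumes "tangle u n 0" and "no_crossing u"
  shows "int (card (row_labellings t n s u)) = count u (\<lambda>_. 1) s"
  using assms
proof (induction u arbitrary: t n s)
  case Nil
  then have "row_labellings t n s [] = {\<lambda>_. undefined}"
    by (auto simp: row_labellings_def labellings_def)
  then show ?case by simp
next
  case (Cons x u)
  from Cons.prems have u: "tangle u (after n x) 0" "no_crossing u"
    by (auto simp: no_crossing_def)
  have card: "card (row_labellings t n s (x # u)) =
    card {g \<in> labellings (points (t + 1) (after n x) u) (arcs (t + 1) (after n x) u).
      \<forall>(p, q) \<in> turning t x \<union> straight t n x. add_row t n s g p = add_row t n s g q}"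
    using row_labellings_Cons[OF Cons.prems(1)] by (metis (lifting) bij_betw_same_card)
  show ?case
  proof (cases x)
    case (Birth i)
    then have n: "i \<le> n" "after n x = n + 2" using Cons.prems by (auto simp: after_def)
    let ?S = "\<lambda>b. row_labellings (t + 1) (n + 2) (insert_two i b b s) u"
    have "card (row_labellings t n s (x # u)) = card (?S True \<union> ?S False)"
      unfolding card unfolding Birth Birth_row_compatible[OF n(1)] n(2)[unfolded Birth]
      by (rule arg_cong[of _ _ card]) (auto simp: row_labellings_def ex_bool_eq)
    \<comment> \<open>The two sets prescribe different labels at position \<open>i\<close> of the
      next slice.\<close>
    moreover have "?S True \<inter> ?S False = {}"
      using n by (auto simp: row_labellings_def snth_insert_two dest!: spec[of _ i])
    ultimately have "int (card (row_labellings t n s (x # u))) =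
        int (card (?S True)) + int (card (?S False))"
      by (simp add: card_Un_disjoint finite_row_labellings)
    then show ?thesis
      using Birth n u Cons.IH by (simp add: cup_eq UNIV_bool)
  next
    case (Death i)
    then have n: "i + 2 \<le> n" "after n x = n - 2" using Cons.prems by (auto simp: after_def)
    have "card (row_labellings t n s (x # u)) =
      card (if s !! i = s !! (i + 1) then row_labellings (t + 1) (n - 2) (delete_two i s) u else {})"
      unfolding card unfolding Death Death_row_compatible[OF n(1)] n(2)[unfolded Death]
      by (rule arg_cong[of _ _ card]) (auto simp: row_labellings_def)
    then show ?thesis
      using Death n u Cons.IH by (simp add: cap_eq)
  next
    case (Cross e i)
    then show ?thesis using Cons.prems by (auto simp: no_crossing_def)
  qed
qed

lemma count_closed:
  assumes "tangle u 0 0" and "no_crossing u"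
  shows "count u (\<lambda>_. 1) s = 2 ^ circles u"
  using card_row_labellings[OF assms, of 0 s]
    card_labellings[OF finite_points arcs_points[OF assms(1), of 0]]
  by (simp add: row_labellings_def circles_def)

section \<open>Reduction of crossingless diagrams\<close>

text \<open>A birth followed at once by a death either cancels with it or lets it pass to the left;
  \<open>m\<close> counts the circles split off. One derivation can thus be evaluated in every
  model.\<close>

inductive reduces :: "piece list \<Rightarrow> nat \<Rightarrow> bool" where
  empty: "reduces [] 0"
| circle: "reduces (p @ q) m \<Longrightarrow> reduces (p @ Birth i # Death i # q) (Suc m)"
| zigzag_up: "reduces (p @ q) m \<Longrightarrow> reduces (p @ Birth i # Death (Suc i) # q) m"
| zigzag_down: "reduces (p @ q) m \<Longrightarrow> reduces (p @ Birth (Suc i) # Death i # q) m"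
| above: "i + 2 \<le> j \<Longrightarrow> reduces (p @ Death (j - 2) # Birth i # q) m \<Longrightarrow>
    reduces (p @ Birth i # Death j # q) m"
| below: "j + 2 \<le> i \<Longrightarrow> reduces (p @ Death j # Birth (i - 2) # q) m \<Longrightarrow>
    reduces (p @ Birth i # Death j # q) m"

text \<open>The exponent comes from the derivation and is the same for all weights, so the counting
  model can identify it.\<close>

lemma (in temperley_lieb) run_reduces:
  "reduces u m \<Longrightarrow> run w u f = (\<lambda>s. \<delta> ^ m * f s)"
proof (induction rule: reduces.induct)
  case (above i j p q m)
  then have "cup c i (cap d j g) = cap d (j - 2) (cup c i g)" for g
    using cup_cap_exchange[of i "j - 2" c d g] by (simp del: add_2_eq_Suc')
  with above.IH show ?case by simp
next
  case (below j i p q m)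
  then have "cap d j (cup c (i - 2) g) = cup c i (cap d j g)" for g
    using cap_cup_exchange[of j "i - 2" d c g] by (simp del: add_2_eq_Suc')
  with below.IH show ?case by simp
qed (simp_all add: cup_cap_Suc cup_Suc_cap cup_cap_same run_scale mult.assoc)

lemma tangle_append: "tangle (u @ v) m n \<longleftrightarrow> (\<exists>k. tangle u m k \<and> tangle v k n)"
  by (induction u arbitrary: m) auto

lemma no_crossing_append [simp]: "no_crossing (u @ v) \<longleftrightarrow> no_crossing u \<and> no_crossing v"
  by (auto simp: no_crossing_def)

lemma no_crossing_simps [simp]:
  "no_crossing []" "no_crossing (Birth i # u) = no_crossing u"
  "no_crossing (Death i # u) = no_crossing u" "\<not> no_crossing (Cross e i # u)"
  by (auto simp: no_crossing_def)

lemma tangle_no_death: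
  "tangle u m n \<Longrightarrow> no_crossing u \<Longrightarrow> (\<And>i. Death i \<notin> set u) \<Longrightarrow> n = m + 2 * length u"
proof (induction u arbitrary: m)
  case (Cons x u)
  then obtain i where "x = Birth i" by (cases x) auto
  with Cons.prems Cons.IH[of "m + 2"] show ?case by (auto simp: after_def)
qed simp

lemma ex_reduces: "tangle u 0 0 \<Longrightarrow> no_crossing u \<Longrightarrow> \<exists>m. reduces u m"
proof (induction "length u" arbitrary: u rule: less_induct)
  case less
  note IH = less.hyps
  \<comment> \<open>Induction on the births before the first death: this death cancels with its left
    neighbour, leaving a shorter word for \<open>IH\<close>, or it moves past it. It cannot come
    first, as a death needs two strands.\<close>
  have first_death: "\<exists>m. reduces (p @ Death j # q) m"
    if "\<And>i. Death i \<notin> set p" "length (p @ Death j # q) = length u"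
      "tangle (p @ Death j # q) 0 0" "no_crossing (p @ Death j # q)" for p j q
    using that
  proof (induction p arbitrary: j q rule: rev_induct)
    case Nil
    then show ?case by simp
  next
    case (snoc x p)
    obtain i where x: "x = Birth i" using snoc.prems by (cases x) auto
    obtain k where k: "tangle p 0 k" "i \<le> k" "j \<le> k" "tangle q k 0"
      using snoc.prems(3) by (auto simp: tangle_append after_def x)
    have cancel: "\<exists>m. reduces (p @ q) m"
      using k snoc.prems by (intro IH) (auto simp: tangle_append x)
    consider "j = i" | "j = Suc i" | "i = Suc j" | "i + 2 \<le> j" | "j + 2 \<le> i" by linarith
    then show ?case
    proof cases
      case 4
      with k have "k - 2 + 2 = k" "j - 2 + 2 \<le> k" "i \<le> k - 2" by auto
      with k have "tangle (p @ Death (j - 2) # Birth i # q) 0 0"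
        unfolding tangle_append by (intro exI[of _ k]) (simp add: after_def)
      with snoc have "\<exists>m. reduces (p @ Death (j - 2) # Birth i # q) m"
        by (intro snoc.IH) (auto simp: x)
      with reduces.above[OF 4] x show ?thesis by auto
    next
      case 5
      with k have "k - 2 + 2 = k" "j + 2 \<le> k" "i - 2 \<le> k - 2" by auto
      with k have "tangle (p @ Death j # Birth (i - 2) # q) 0 0"
        unfolding tangle_append by (intro exI[of _ k]) (simp add: after_def)
      with snoc have "\<exists>m. reduces (p @ Death j # Birth (i - 2) # q) m"
        by (intro snoc.IH) (auto simp: x)
      with reduces.below[OF 5] x show ?thesis by auto
    qed (use cancel x in \<open>auto intro: reduces.intros\<close>)
  qed
  show ?case
  proof (cases "\<exists>i. Death i \<in> set u")
    case True
    then have "\<exists>x\<in>set u. \<exists>i. x = Death i" by blast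
    then obtain p x q where u: "u = p @ x # q" "\<exists>i. x = Death i" "\<forall>y\<in>set p. \<not> (\<exists>i. y = Death i)"
      using split_list_first_prop[of u "\<lambda>x. \<exists>i. x = Death i"] by blast
    then obtain j where "x = Death j" by blast
    with u show ?thesis using first_death[of p j q] less.prems by blast
  next
    case False
    \<comment> \<open>Without deaths the number of strands only grows, so a closed word has no
      births either.\<close>
    then have "u = []" using tangle_no_death less.prems by fastforce
    then show ?thesis using reduces.empty by auto
  qed
qed

text \<open>The counting model yields \<open>2 ^ circles u\<close> through labellings and
  \<open>2 ^ m\<close> through the derivation.\<close>

lemma reduces_circles:
  assumes "tangle u 0 0" and "no_crossing u" and "reduces u m"
  shows "circles u = m"
proof -
  have "(2 :: int) ^ circles u = 2 ^ m"
    using count_closed[OF assms(1,2), of undefined] counting.run_reduces[OF assms(3)] by simp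
  then show ?thesis by simp
qed

lemma (in temperley_lieb) run_closed:
  assumes "tangle u 0 0" and "no_crossing u"
  shows "run w u f = (\<lambda>s. \<delta> ^ circles u * f s)"
  using ex_reduces[OF assms] reduces_circles[OF assms] run_reduces by blast

section \<open>The half-turn\<close>

text \<open>Applied to a product, this is the pairing of functions on \<open>n\<close> strands for
  which cups and caps are adjoint.\<close>

primrec prefix_sum :: "nat \<Rightarrow> (bool stream \<Rightarrow> int) \<Rightarrow> bool stream \<Rightarrow> int" where
  "prefix_sum 0 f s = f s"
| "prefix_sum (Suc n) f s = (\<Sum>b\<in>UNIV. prefix_sum n (\<lambda>t. f (b ## t)) s)"

lemma prefix_sum_sum:
  "prefix_sum n (\<lambda>t. \<Sum>x\<in>A. f x t) s = (\<Sum>x\<in>A. prefix_sum n (f x) s)"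
  by (induction n arbitrary: f) (simp_all, rule sum.swap)

lemma cup_cap_adjoint:
  "i \<le> n \<Longrightarrow> prefix_sum n (\<lambda>t. g t * cup e i f t) s = prefix_sum (n + 2) (\<lambda>t. cap e i g t * f t) s"
proof (induction i arbitrary: n f g)
  case 0
  show ?case
    by (simp add: cup.simps cap.simps prefix_sum_sum sum_distrib_left mult_ac)
next
  case (Suc i)
  then obtain n' where "n = Suc n'" "i \<le> n'" by (cases n) auto
  with Suc.IH show ?case by (simp add: cup.simps cap.simps)
qed

lemma reverse_prefix_reverse_prefix [simp]: "reverse_prefix n (reverse_prefix n s) = s"
  by (rule stream_eqI) (auto simp: snth_reverse_prefix)

text \<open>Reversing a row mirrors the picture top to bottom and swaps the ends of the arc, hence
  the symmetry of \<open>e\<close>. The weights of the bracket lack it, which is why the half-turn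
  is treated in the counting model.\<close>

lemma cap_reverse_prefix:
  assumes "i \<le> n" and sym: "\<And>x y. e x y = e y x"
  shows "cap e i g (reverse_prefix (n + 2) s) = cap e (n - i) (\<lambda>t. g (reverse_prefix n t)) s"
proof -
  have "delete_two i (reverse_prefix (n + 2) s) = reverse_prefix n (delete_two (n - i) s)"
  proof (rule stream_eqI)
    fix j
    obtain l where l: "n = i + l" using assms(1) le_Suc_ex by blast
    have "j + 1 \<le> i \<or> i \<le> j" by linarith
    then consider k where "i = j + 1 + k" | k where "j = i + k"
      by (auto simp: le_iff_add)
    then show "delete_two i (reverse_prefix (n + 2) s) !! j =
        reverse_prefix n (delete_two (n - i) s) !! j"
      by cases (auto simp: l snth_reverse_prefix snth_delete_two simp del: snth.simps)
  qed
  then show ?thesis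
    using assms(1) by (simp add: cap_eq snth_reverse_prefix sym Suc_diff_le del: snth.simps)
qed

lemma cup_reverse_prefix:
  assumes "i \<le> n" and sym: "\<And>x y. e x y = e y x"
  shows "cup e i g (reverse_prefix n s) = cup e (n - i) (\<lambda>t. g (reverse_prefix (n + 2) t)) s"
proof -
  have eq: "insert_two i x y (reverse_prefix n s) = reverse_prefix (n + 2) (insert_two (n - i) y x s)"
    for x y
  proof (rule stream_eqI)
    fix j
    obtain l where l: "n = i + l" using assms(1) le_Suc_ex by blast
    have "j + 1 \<le> i \<or> j = i \<or> j = i + 1 \<or> i + 2 \<le> j" by linarith
    then consider k where "i = j + 1 + k" | "j = i" | "j = i + 1" | k where "j = i + 2 + k"
      by (auto simp: le_iff_add)
    then show "insert_two i x y (reverse_prefix n s) !! j =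
        reverse_prefix (n + 2) (insert_two (n - i) y x s) !! j"
      by cases (auto simp: l snth_reverse_prefix snth_insert_two simp del: snth.simps)
  qed
  show ?thesis
    unfolding cup_eq eq by (subst sum.swap) (simp add: sym)
qed

text \<open>Adjunction of cups and caps supplies the left-right mirror image, reversal of rows the
  top-bottom one; together they give the half-turn.\<close>

lemma count_rot_pieces:
  assumes "tangle u n m" and "no_crossing u"
  shows "prefix_sum n (\<lambda>t. g t * count u f t) s =
    prefix_sum m (\<lambda>t. count (rot_pieces n u) (\<lambda>t. g (reverse_prefix n t)) (reverse_prefix m t) * f t) s"
  using assms
proof (induction u arbitrary: n g)
  case Nil
  then show ?case by simp
next
  case (Cons x u)
  show ?case
  proof (cases x)
    case (Birth i)
    then have n: "i \<le> n" "after n x = n + 2" using Cons.prems by (auto simp: after_def)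
    with Birth Cons show ?thesis
      by (simp add: cup_cap_adjoint cap_reverse_prefix eq_commute del: add_2_eq_Suc')
  next
    case (Death i)
    then have n: "i + 2 \<le> n" "after n x = n - 2" using Cons.prems by (auto simp: after_def)
    then have "n - 2 + 2 = n" by simp
    with Death Cons n cup_cap_adjoint[of i "n - 2" "count u f" "\<lambda>x y. of_bool (x = y)" g s]
      cup_reverse_prefix[of i "n - 2" "\<lambda>x y. of_bool (x = y)" g]
    show ?thesis
      by (simp add: eq_commute mult.commute del: add_2_eq_Suc' eq_commute)
  next
    case (Cross e i)
    then show ?thesis using Cons.prems by simp
  qed
qed

lemma tangle_rot_pieces: "tangle u n m \<Longrightarrow> tangle (rot_pieces n u) m n"
proof (induction u arbitrary: n)
  case (Cons x u)
  then have "tangle (rot_pieces (after n x) u) m (after n x)" by simp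
  moreover have "tangle [rot_piece n x] (after n x) n"
    using Cons.prems by (cases x) (auto simp: after_def)
  ultimately show ?case by (auto simp: tangle_append)
qed simp

lemma no_crossing_rot_pieces [simp]: "no_crossing (rot_pieces n u) = no_crossing u"
proof (induction u arbitrary: n)
  case (Cons x u)
  then show ?case by (cases x) simp_all
qed simp

lemma circles_rot_pieces:
  assumes "tangle u 0 0" and "no_crossing u"
  shows "circles (rot_pieces 0 u) = circles u"
proof -
  \<comment> \<open>On zero strands the pairing is a plain product and the reversal is
    trivial.\<close>
  have "count u (\<lambda>_. 1) s = count (rot_pieces 0 u) (\<lambda>_. 1) s" for s
    using count_rot_pieces[OF assms, of "\<lambda>_. 1" "\<lambda>_. 1"] by (simp add: reverse_prefix_def)
  then have "(2 :: int) ^ circles u = 2 ^ circles (rot_pieces 0 u)"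
    using assms by (simp add: count_closed tangle_rot_pieces)
  then show ?thesis by simp
qed

section \<open>The state sum\<close>

lemma varA_nonzero: "varA \<noteq> 0"
  by (simp add: varA_def Zero_fract_def eq_fract)

lemma varB_nonzero: "varB \<noteq> 0"
  by (simp add: varB_def Zero_fract_def eq_fract)

text \<open>Setting both variables to 1 would give 1 = -1. This keeps \<open>deltaA\<close> and
  \<open>deltaB\<close> from vanishing.\<close>

lemma poly_power_neq_minus_one:
  assumes "poly (poly p 1) 1 = (1 :: int)"
  shows "Fract p 1 ^ n \<noteq> (- 1 :: ratfun)"
proof
  have power: "Fract p 1 ^ n = (Fract (p ^ n) 1 :: ratfun)"
    by (induction n) (simp_all add: One_fract_def)
  assume "Fract p 1 ^ n = (- 1 :: ratfun)"
  then have "p ^ n = - 1"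
    unfolding power by (simp add: One_fract_def eq_fract)
  then have "poly (poly (p ^ n) 1) 1 = poly (poly (- 1) 1) 1" by simp
  with assms show False by (simp add: poly_power)
qed

lemma minus_square_minus_inverse_nonzero:
  fixes x :: ratfun
  assumes "x \<noteq> 0" and "x ^ 4 \<noteq> - 1"
  shows "- (x ^ 2) - inverse (x ^ 2) \<noteq> 0"
proof
  assume "- (x ^ 2) - inverse (x ^ 2) = 0"
  then have "x ^ 2 * (- (x ^ 2) - inverse (x ^ 2)) = 0" by simp
  then have "- (x ^ 4) - 1 = 0" using assms(1) by (simp add: algebra_simps flip: power_add)
  with assms(2) show False by (simp add: algebra_simps eq_neg_iff_add_eq_0)
qed

lemma deltaA_nonzero: "deltaA \<noteq> 0"
  unfolding deltaA_def
  by (intro minus_square_minus_inverse_nonzero varA_nonzero)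
    (auto simp: varA_def intro!: poly_power_neq_minus_one)

lemma deltaB_nonzero: "deltaB \<noteq> 0"
  unfolding deltaB_def
  by (intro minus_square_minus_inverse_nonzero varB_nonzero)
    (auto simp: varB_def intro!: poly_power_neq_minus_one)

text \<open>Chosen so that the value of \<open>n\<close> circles meeting the axis in
  \<open>2 * m\<close> points reads \<open>rho ^ m / deltaB * deltaA ^ n\<close>: the operators only
  count circles, and each pair of points on the axis costs one \<open>rho\<close>.\<close>

definition rho :: ratfun where
  "rho = deltaB / deltaA"

lemma rho_nonzero: "rho \<noteq> 0"
  by (simp add: rho_def deltaA_nonzero deltaB_nonzero)

fun off_weight :: "crossing \<Rightarrow> ratfun" where
  "off_weight Xo = varA"
| "off_weight Xu = inverse varA"

fun on_weight :: "crossing \<Rightarrow> ratfun" where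
  "on_weight Xo = varB"
| "on_weight Xu = inverse varB"

text \<open>
  The vertical smoothing has two strands fewer on the axis; the division by \<open>rho\<close> compensates for
  the factor \<open>rho ^ (width a div 2)\<close> of the state sum.
\<close>

definition on_weight_v :: "crossing \<Rightarrow> ratfun" where
  "on_weight_v c = on_weight (opp c) / rho"

definition cup_weight :: "bool \<Rightarrow> bool \<Rightarrow> ratfun" where
  "cup_weight x y = (if x = y then 0 else if x then - (varA ^ 2) else 1)"

definition cap_weight :: "bool \<Rightarrow> bool \<Rightarrow> ratfun" where
  "cap_weight x y = (if x = y then 0 else if x then 1 else - inverse (varA ^ 2))"

interpretation kauffman cup_weight cap_weight deltaA off_weight
proof
  show "(\<Sum>y\<in>UNIV. cup_weight x y * cap_weight y z) = of_bool (x = z)" for x z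
    using varA_nonzero by (cases x; cases z) (simp_all add: UNIV_bool cup_weight_def cap_weight_def)
  show "(\<Sum>y\<in>UNIV. cap_weight x y * cup_weight y z) = of_bool (x = z)" for x z
    using varA_nonzero by (cases x; cases z) (simp_all add: UNIV_bool cup_weight_def cap_weight_def)
  show "(\<Sum>x\<in>UNIV. \<Sum>y\<in>UNIV. cup_weight x y * cap_weight x y) = deltaA"
    by (simp add: UNIV_bool cup_weight_def cap_weight_def deltaA_def)
  show "off_weight e * off_weight (opp e) = 1" for e
    using varA_nonzero by (cases e) simp_all
  show "deltaA = - (off_weight e)\<^sup>2 - (off_weight (opp e))\<^sup>2" for e
    by (cases e) (simp_all add: deltaA_def power_inverse)
qed

abbreviation off :: "piece list \<Rightarrow> (bool stream \<Rightarrow> ratfun) \<Rightarrow> bool stream \<Rightarrow> ratfun" where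
  "off \<equiv> run off_weight"

abbreviation on :: "nat \<Rightarrow> slot list \<Rightarrow> (bool stream \<Rightarrow> ratfun) \<Rightarrow> bool stream \<Rightarrow> ratfun" where
  "on \<equiv> axis on_weight on_weight_v"

text \<open>The stream at which the operator is evaluated is irrelevant for a valid word.\<close>

fun state_sum :: "word \<Rightarrow> ratfun" where
  "state_sum (Word l a r) =
     rho ^ (width a div 2) / deltaB * off l (on 0 a (off r (\<lambda>_. 1))) (sconst False)"

text \<open>The rules are stated on words because the state sum lives there; its half-turn
  invariance, required for the descent to diagrams, comes from uniqueness on this level.\<close>

definition bracket_rules :: "(word \<Rightarrow> ratfun) \<Rightarrow> bool" where
  "bracket_rules F \<longleftrightarrow>
     (\<forall>p c i q a r. valid (Word (p @ [Cross c i] @ q) a r) \<longrightarrow>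
        F (Word (p @ [Cross c i] @ q) a r) =
          varA * F (Word (p @ smooth_A c i @ q) a r) +
          inverse varA * F (Word (p @ smooth_B c i @ q) a r)) \<and>
     (\<forall>l a p c i q. valid (Word l a (p @ [Cross c i] @ q)) \<longrightarrow>
        F (Word l a (p @ [Cross c i] @ q)) =
          varA * F (Word l a (p @ smooth_A c i @ q)) +
          inverse varA * F (Word l a (p @ smooth_B c i @ q))) \<and>
     (\<forall>l lo c hi r. valid (Word l (lo @ [OnAxis c] @ hi) r) \<longrightarrow>
        F (Word l (lo @ [OnAxis c] @ hi) r) =
          on_weight c * F (smooth_h l lo hi r) + on_weight (opp c) * F (smooth_v l lo hi r)) \<and>
     (\<forall>l m r. valid (Word l (replicate (2 * m) Thru) r) \<and> no_crossing l \<and> no_crossing r \<longrightarrow>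
        F (Word l (replicate (2 * m) Thru) r) =
          deltaA powi (int (circles (l @ r)) - int m) * deltaB powi (int m - 1))"

lemma bracket_rules_diag:
  "skein_off_axis f \<and> skein_on_axis f \<and> circle_formula f \<longleftrightarrow> bracket_rules (\<lambda>W. f (diag W))"
proof -
  have all_crossing: "(\<forall>c. P c) \<longleftrightarrow> P Xo \<and> P Xu" for P
    by (metis crossing.exhaust)
  have "skein_on_axis f \<longleftrightarrow>
     (\<forall>c l lo hi r. valid (Word l (lo @ [OnAxis c] @ hi) r) \<longrightarrow>
        f (diag (Word l (lo @ [OnAxis c] @ hi) r)) =
          on_weight c * f (diag (smooth_h l lo hi r)) + on_weight (opp c) * f (diag (smooth_v l lo hi r)))"
    unfolding all_crossing skein_on_axis_def by simp
  also have "\<dots> \<longleftrightarrow>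
     (\<forall>l lo c hi r. valid (Word l (lo @ [OnAxis c] @ hi) r) \<longrightarrow>
        f (diag (Word l (lo @ [OnAxis c] @ hi) r)) =
          on_weight c * f (diag (smooth_h l lo hi r)) + on_weight (opp c) * f (diag (smooth_v l lo hi r)))"
    by blast
  finally show ?thesis
    unfolding skein_off_axis_def circle_formula_def bracket_rules_def by (simp only: conj_assoc)
qed

section \<open>Uniqueness of a function obeying the rules\<close>

lemma width_simps [simp]:
  "width [] = 0" "width (t # a) = slot_width t + width a" "width (a @ b) = width a + width b"
  "width (rev a) = width a"
  by (simp_all add: width_def rev_map[symmetric] sum_list_rev)

lemma tangle_Cross: "tangle (Cross c i # u) m n \<longleftrightarrow> i + 2 \<le> m \<and> tangle u m n"
  by (cases "i + 2 \<le> m") (simp_all add: after_def del: add_2_eq_Suc')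

lemma tangle_Death_Birth:
  "tangle (Death i # Birth i # u) m n \<longleftrightarrow> i + 2 \<le> m \<and> tangle u m n"
  by (cases "i + 2 \<le> m") (auto simp: after_def le_diff_conv2 simp del: add_2_eq_Suc')

lemma tangle_smooth:
  assumes "tangle (p @ [Cross c i] @ q) m n"
  shows "tangle (p @ smooth_A c i @ q) m n" and "tangle (p @ smooth_B c i @ q) m n"
  using assms
  by (cases c; auto simp: tangle_append tangle_Cross tangle_Death_Birth horizontal_def vertical_def
        simp del: tangle.simps(2))+

lemma valid_smooth_axis:
  assumes "valid (Word l (lo @ [OnAxis c] @ hi) r)"
  shows "valid (smooth_h l lo hi r)" and "valid (smooth_v l lo hi r)"
  using assms by (auto simp: smooth_h_def smooth_v_def tangle_append after_def add.commute numeral_2_eq_2)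

lemma width_replicate_Thru: "width (replicate n Thru) = n"
  by (induction n) simp_all

fun num_crossings :: "word \<Rightarrow> nat" where
  "num_crossings (Word l a r) =
     length (filter (\<lambda>x. \<not> no_crossing [x]) (l @ r)) + length (filter (\<lambda>t. t \<noteq> Thru) a)"

lemma tangle_parity: "tangle u m n \<Longrightarrow> even m = even n"
proof (induction u arbitrary: m)
  case (Cons x u)
  then have "even (after m x) = even m"
    by (cases x) (auto simp: after_def)
  with Cons show ?case by auto
qed simp

lemma bracket_rules_unique:
  assumes F: "bracket_rules F" and G: "bracket_rules G"
  shows "valid W \<Longrightarrow> F W = G W"
proof (induction "num_crossings W" arbitrary: W rule: less_induct)
  case less
  obtain l a r where W: "W = Word l a r" by (cases W)
  have crossing_free: "no_crossing u" if "\<And>c i. Cross c i \<notin> set u" for u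
    using that by (simp add: no_crossing_def)
  consider p c i q where "l = p @ [Cross c i] @ q" | p c i q where "r = p @ [Cross c i] @ q"
    | lo c hi where "a = lo @ [OnAxis c] @ hi"
    | "no_crossing l" "no_crossing r" "\<And>c. OnAxis c \<notin> set a"
    unfolding no_crossing_def by (metis append_Cons append_Nil split_list)
  then show ?case
  proof cases
    case 1
    have "F V = G V" if "V \<in> {Word (p @ smooth_A c i @ q) a r, Word (p @ smooth_B c i @ q) a r}" for V
      using less.prems that tangle_smooth[of p c i q] unfolding W 1
      by (intro less.hyps; cases c) (auto simp: W 1 horizontal_def vertical_def)
    then show ?thesis
      using F G less.prems unfolding W 1 bracket_rules_def by simp
  next
    case 2
    have "F V = G V" if "V \<in> {Word l a (p @ smooth_A c i @ q), Word l a (p @ smooth_B c i @ q)}" for V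
      using less.prems that tangle_smooth[of p c i q] unfolding W 2
      by (intro less.hyps; cases c) (auto simp: W 2 horizontal_def vertical_def)
    then show ?thesis
      using F G less.prems unfolding W 2 bracket_rules_def by simp
  next
    case 3
    have "F V = G V" if "V \<in> {smooth_h l lo hi r, smooth_v l lo hi r}" for V
      using less.prems that valid_smooth_axis[of l lo c hi r] unfolding W 3
      by (intro less.hyps) (auto simp: W 3 smooth_h_def smooth_v_def)
    then show ?thesis
      using F G less.prems unfolding W 3 bracket_rules_def by simp
  next
    case 4
    have "t = Thru" if "t \<in> set a" for t using 4(3) that by (cases t) auto
    then have a: "a = replicate (length a) Thru" by (metis replicate_length_same)
    then have "width a = length a" by (metis width_replicate_Thru)
    \<comment> \<open>The left half starts with no strands and pieces preserve parity, so the circle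
      rule with its \<open>2 * m\<close> slots applies.\<close>
    then have "even (length a)" using less.prems tangle_parity[of l 0 "width a"] W by simp
    then obtain m where "a = replicate (2 * m) Thru" using a by (metis evenE)
    then show ?thesis
      using F G less.prems 4 unfolding W bracket_rules_def by simp
  qed
qed

section \<open>Compatibility of the rules with the half-turn\<close>

lemma rot_pieces_append:
  "tangle u n k \<Longrightarrow> rot_pieces n (u @ v) = rot_pieces k v @ rot_pieces n u"
  by (induction u arbitrary: n) auto

lemma rot_pieces_smooth:
  "rot_pieces k (smooth_A c i) = smooth_A c (k - 2 - i)"
  "rot_pieces k (smooth_B c i) = smooth_B c (k - 2 - i)"
  by (cases c; simp add: horizontal_def vertical_def after_def)+

lemma valid_half_turn: "valid W \<Longrightarrow> valid (half_turn W)"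
  by (cases W) (auto intro: tangle_rot_pieces)

text \<open>A half-turn keeps the type of a crossing and each of its smoothings. \<open>k\<close> is
  the number of strands at the crossing.\<close>

lemma rot_pieces_context:
  assumes "tangle (p @ [Cross c i] @ q) m n"
  obtains k where
    "rot_pieces m (p @ [Cross c i] @ q) = rot_pieces k q @ [Cross c (k - 2 - i)] @ rot_pieces m p"
    "rot_pieces m (p @ smooth_A c i @ q) = rot_pieces k q @ smooth_A c (k - 2 - i) @ rot_pieces m p"
    "rot_pieces m (p @ smooth_B c i @ q) = rot_pieces k q @ smooth_B c (k - 2 - i) @ rot_pieces m p"
proof -
  obtain k where k: "tangle p m k" "i + 2 \<le> k" "tangle q k n"
    using assms by (auto simp: tangle_append tangle_Cross simp del: tangle.simps(2))
  then have "tangle [Cross c i] k k" "tangle (smooth_A c i) k k" "tangle (smooth_B c i) k k"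
    by (cases c; auto simp: tangle_Cross tangle_Death_Birth horizontal_def vertical_def
        simp del: tangle.simps(2))+
  with that k(1) show thesis
    by (simp add: rot_pieces_append rot_pieces_smooth after_def)
qed

lemma bracket_rules_half_turn:
  assumes F: "bracket_rules F"
  shows "bracket_rules (\<lambda>W. F (half_turn W))"
  unfolding bracket_rules_def
proof (intro conjI allI impI)
  fix p c i q a r assume v: "valid (Word (p @ [Cross c i] @ q) a r)"
  then obtain k where k:
    "rot_pieces 0 (p @ [Cross c i] @ q) = rot_pieces k q @ [Cross c (k - 2 - i)] @ rot_pieces 0 p"
    "rot_pieces 0 (p @ smooth_A c i @ q) = rot_pieces k q @ smooth_A c (k - 2 - i) @ rot_pieces 0 p"
    "rot_pieces 0 (p @ smooth_B c i @ q) = rot_pieces k q @ smooth_B c (k - 2 - i) @ rot_pieces 0 p"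
    unfolding valid.simps by (blast elim: rot_pieces_context)
  show "F (half_turn (Word (p @ [Cross c i] @ q) a r)) =
      varA * F (half_turn (Word (p @ smooth_A c i @ q) a r)) +
      inverse varA * F (half_turn (Word (p @ smooth_B c i @ q) a r))"
    using valid_half_turn[OF v] F unfolding half_turn.simps k bracket_rules_def by blast
next
  fix l a p c i q assume v: "valid (Word l a (p @ [Cross c i] @ q))"
  then obtain k where k:
    "rot_pieces (width a) (p @ [Cross c i] @ q) =
       rot_pieces k q @ [Cross c (k - 2 - i)] @ rot_pieces (width a) p"
    "rot_pieces (width a) (p @ smooth_A c i @ q) =
       rot_pieces k q @ smooth_A c (k - 2 - i) @ rot_pieces (width a) p"
    "rot_pieces (width a) (p @ smooth_B c i @ q) =
       rot_pieces k q @ smooth_B c (k - 2 - i) @ rot_pieces (width a) p"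
    unfolding valid.simps by (blast elim: rot_pieces_context)
  show "F (half_turn (Word l a (p @ [Cross c i] @ q))) =
      varA * F (half_turn (Word l a (p @ smooth_A c i @ q))) +
      inverse varA * F (half_turn (Word l a (p @ smooth_B c i @ q)))"
    using valid_half_turn[OF v] F unfolding half_turn.simps k bracket_rules_def by blast
next
  fix l lo c hi r assume v: "valid (Word l (lo @ [OnAxis c] @ hi) r)"
  let ?w = "width lo + 2 + width hi"
  let ?l = "rot_pieces ?w r" and ?r = "rot_pieces 0 l"
  have l: "tangle l 0 ?w" using v by (simp add: add.assoc add.commute)
  have turn: "half_turn (Word l (lo @ [OnAxis c] @ hi) r) = Word ?l (rev hi @ [OnAxis c] @ rev lo) ?r"
    "half_turn (smooth_h l lo hi r) = smooth_h ?l (rev hi) (rev lo) ?r"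
    by (simp_all add: smooth_h_def)
  have "half_turn (smooth_v l lo hi r) = smooth_v ?l (rev hi) (rev lo) ?r"
    by (simp add: smooth_v_def rot_pieces_append[OF l] after_def)
  with turn v show "F (half_turn (Word l (lo @ [OnAxis c] @ hi) r)) =
      on_weight c * F (half_turn (smooth_h l lo hi r)) +
      on_weight (opp c) * F (half_turn (smooth_v l lo hi r))"
    using valid_half_turn[OF v] F unfolding bracket_rules_def by simp
next
  fix l m r
  assume v: "valid (Word l (replicate (2 * m) Thru) r) \<and> no_crossing l \<and> no_crossing r"
  let ?w = "width (replicate (2 * m) Thru)"
  have t: "tangle l 0 ?w" "tangle (l @ r) 0 0" using v by (auto simp: tangle_append)
  \<comment> \<open>The two turned halves in exchanged order form the half-turn of the closed word
    \<open>l @ r\<close>.\<close>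
  have "circles (rot_pieces ?w r @ rot_pieces 0 l) = circles (l @ r)"
    using circles_rot_pieces[OF t(2)] v by (simp add: rot_pieces_append[OF t(1)])
  then show "F (half_turn (Word l (replicate (2 * m) Thru) r)) =
      deltaA powi (int (circles (l @ r)) - int m) * deltaB powi (int m - 1)"
    using valid_half_turn v F unfolding bracket_rules_def by (simp add: tangle_rot_pieces)
qed

section \<open>The state sum obeys the rules\<close>

lemma state_sum_append:
  "state_sum (Word (p @ u) (lo @ s @ hi) (v @ q)) =
     rho ^ (width (lo @ s @ hi) div 2) / deltaB *
     off p (off u (on 0 lo (on (width lo) s (on (width lo + width s) hi (off v (off q (\<lambda>_. 1)))))))
       (sconst False)"
  by (simp add: axis_append)

lemma on_replicate_Thru: "on j (replicate n Thru) f = f"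
  by (induction n arbitrary: j) simp_all

lemma bracket_rules_state_sum: "bracket_rules state_sum"
  unfolding bracket_rules_def
proof (intro conjI allI impI)
  fix p c i q a r
  show "state_sum (Word (p @ [Cross c i] @ q) a r) =
      varA * state_sum (Word (p @ smooth_A c i @ q) a r) +
      inverse varA * state_sum (Word (p @ smooth_B c i @ q) a r)"
    by (cases c) (simp_all add: braid_def run_linear horizontal_def vertical_def algebra_simps)
next
  fix l a p c i q
  show "state_sum (Word l a (p @ [Cross c i] @ q)) =
      varA * state_sum (Word l a (p @ smooth_A c i @ q)) +
      inverse varA * state_sum (Word l a (p @ smooth_B c i @ q))"
    by (cases c)
      (simp_all add: braid_def run_linear axis_linear horizontal_def vertical_def algebra_simps)
next
  fix l lo c hi r assume "valid (Word l (lo @ [OnAxis c] @ hi) r)"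
  let ?R = "off r (\<lambda>_. 1)" and ?k = "width lo"
  \<comment> \<open>In \<open>smooth_v\<close> the slots \<open>lo\<close> and \<open>hi\<close>
    separate the two new arcs. Moving the cap above \<open>lo\<close> and the cup below
    \<open>hi\<close> makes them adjacent, as in the vertical term of \<open>braid\<close>.\<close>
  have "cap cap_weight ?k (on 0 lo (on ?k hi (cup cup_weight ?k ?R))) =
      on 0 lo (cap cap_weight ?k (cup cup_weight ?k (on (?k + 2) hi ?R)))"
    using axis_act_above[of 0 lo "Death ?k" off_weight on_weight on_weight_v]
      axis_act_below[of "Birth ?k" ?k on_weight on_weight_v hi off_weight ?R] by simp
  moreover have "rho ^ ((?k + (2 + width hi)) div 2) = rho * rho ^ ((?k + width hi) div 2)"
    by simp
  ultimately show "state_sum (Word l (lo @ [OnAxis c] @ hi) r) =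
      on_weight c * state_sum (smooth_h l lo hi r) + on_weight (opp c) * state_sum (smooth_v l lo hi r)"
    by (simp add: smooth_h_def smooth_v_def axis_append braid_def run_linear axis_linear,
        simp add: on_weight_v_def rho_nonzero deltaB_nonzero field_simps)
next
  fix l m r
  assume v: "valid (Word l (replicate (2 * m) Thru) r) \<and> no_crossing l \<and> no_crossing r"
  then have "off (l @ r) (\<lambda>_. 1) = (\<lambda>s. deltaA ^ circles (l @ r) * 1)"
    by (intro run_closed) (auto simp: tangle_append)
  then show "state_sum (Word l (replicate (2 * m) Thru) r) =
      deltaA powi (int (circles (l @ r)) - int m) * deltaB powi (int m - 1)"
    using deltaA_nonzero deltaB_nonzero
    by (simp add: width_replicate_Thru on_replicate_Thru power_int_diff rho_def power_divide)
qed

text \<open>Smoothings preserve validity, so the rules see valid words only. This carries them from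
  \<open>state_sum\<close> to its descent through \<open>diag\<close>.\<close>

lemma bracket_rules_cong:
  assumes F: "bracket_rules F" and eq: "\<And>V. valid V \<Longrightarrow> G V = F V"
  shows "bracket_rules G"
  unfolding bracket_rules_def
proof (intro conjI allI impI)
  fix p c i q a r assume v: "valid (Word (p @ [Cross c i] @ q) a r)"
  then have "valid (Word (p @ smooth_A c i @ q) a r)" "valid (Word (p @ smooth_B c i @ q) a r)"
    using tangle_smooth by auto
  with v show "G (Word (p @ [Cross c i] @ q) a r) =
      varA * G (Word (p @ smooth_A c i @ q) a r) +
      inverse varA * G (Word (p @ smooth_B c i @ q) a r)"
    using F eq unfolding bracket_rules_def by (metis (no_types))
next
  fix l a p c i q assume v: "valid (Word l a (p @ [Cross c i] @ q))"
  then have "valid (Word l a (p @ smooth_A c i @ q))" "valid (Word l a (p @ smooth_B c i @ q))"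
    using tangle_smooth by auto
  with v show "G (Word l a (p @ [Cross c i] @ q)) =
      varA * G (Word l a (p @ smooth_A c i @ q)) +
      inverse varA * G (Word l a (p @ smooth_B c i @ q))"
    using F eq unfolding bracket_rules_def by (metis (no_types))
next
  fix l lo c hi r assume v: "valid (Word l (lo @ [OnAxis c] @ hi) r)"
  show "G (Word l (lo @ [OnAxis c] @ hi) r) =
      on_weight c * G (smooth_h l lo hi r) + on_weight (opp c) * G (smooth_v l lo hi r)"
    using F v eq[OF v] eq[OF valid_smooth_axis(1)[OF v]] eq[OF valid_smooth_axis(2)[OF v]]
    unfolding bracket_rules_def by simp
next
  fix l m r
  assume v: "valid (Word l (replicate (2 * m) Thru) r) \<and> no_crossing l \<and> no_crossing r"
  with F show "G (Word l (replicate (2 * m) Thru) r) =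
      deltaA powi (int (circles (l @ r)) - int m) * deltaB powi (int m - 1)"
    unfolding eq[OF conjunct1[OF v]] bracket_rules_def by blast
qed

section \<open>Descent to diagrams\<close>

lemma same_diagram_valid: "same_diagram W W' \<Longrightarrow> valid W \<and> valid W'"
  by (induction rule: same_diagram.induct) auto

lemma same_diagram_state_sum: "same_diagram W W' \<Longrightarrow> state_sum W = state_sum W'"
proof (induction rule: same_diagram.induct)
  case (left u u' p q a r)
  then show ?case by (simp add: run_planar_move)
next
  case (right u u' l a p q)
  then show ?case by (simp add: run_planar_move)
next
  \<comment> \<open>The state sum before and after the half-turn both obey the rules, so uniqueness
    applies.\<close>
  case (turn W)
  then show ?case
    using bracket_rules_unique[OF bracket_rules_state_sum
        bracket_rules_half_turn[OF bracket_rules_state_sum]] by blast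
qed auto

lemma diagram_cases:
  obtains W where "valid W" "D = diag W"
proof
  show "valid (rep_diagram D)"
    using Quotient_rep_reflp[OF Quotient_diagram] same_diagram_valid by blast
  show "D = diag (rep_diagram D)"
    by (simp add: Quotient_abs_rep[OF Quotient_diagram])
qed

text \<open>Existence and uniqueness together let the definite description in \<open>bracket\<close>
  denote the descended state sum.\<close>

lemma bracket_diag:
  assumes "valid W"
  shows "bracket (diag W) = state_sum W"
proof -
  define f where "f D = state_sum (rep_diagram D)" for D
  have f: "f (diag V) = state_sum V" if "valid V" for V
    using Quotient_rep_abs[OF Quotient_diagram same_diagram.refl[OF that]]
    by (simp add: f_def same_diagram_state_sum)
  have "bracket_rules (\<lambda>V. f (diag V))"
    using bracket_rules_state_sum f by (rule bracket_rules_cong)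
  then have "skein_off_axis f \<and> skein_on_axis f \<and> circle_formula f"
    by (simp only: bracket_rules_diag)
  moreover have "g = f" if "skein_off_axis g \<and> skein_on_axis g \<and> circle_formula g" for g
  proof
    fix D
    obtain V where "valid V" "D = diag V" by (rule diagram_cases)
    then show "g D = f D"
      using bracket_rules_unique[OF that[unfolded bracket_rules_diag] bracket_rules_state_sum] f
      by simp
  qed
  ultimately have "bracket = f"
    unfolding bracket_def by (rule the_equality)
  with f assms show ?thesis by simp
qed

section \<open>Invariance under the moves\<close>

text \<open>The factor \<open>\<kappa>\<close> is 1 for R2 and R3 and the kink value for R1;
  operators outside the disk are linear and let it out.\<close>

lemma off_axis_bracket:
  assumes "off_axis M D D'"
    and local: "\<And>u u' f. M u u' \<Longrightarrow> off u' f = (\<lambda>s. \<kappa> * off u f s)"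
  shows "bracket D' = \<kappa> * bracket D"
  using assms(1)
proof cases
  case (1 u u' p q a r)
  then show ?thesis by (simp add: bracket_diag local run_scale)
next
  case (2 u u' l a p q)
  then show ?thesis by (simp add: bracket_diag local run_scale axis_scale)
qed

lemma on_off_above: "\<forall>x\<in>set u. width lo \<le> pos x \<Longrightarrow> off u (on 0 lo f) = on 0 lo (off u f)"
  by (induction u) (simp_all add: axis_act_above)

lemma on_off_below: "tangle u j k \<Longrightarrow> on j hi (off u f) = off u (on k hi f)"
proof (induction u arbitrary: j)
  case (Cons x u)
  then have "on j hi (off (x # u) f) = act off_weight x (on (after j x) hi (off u f))"
    unfolding after_def by (simp only: run.simps axis_act_below tangle.simps)
  with Cons show ?case by simp
qed simp

text \<open>The disk is isolated by commuting its left pieces past the slots below and its right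
  pieces past those above. The common \<open>m\<close> makes \<open>hi\<close> start at the same
  strand on both sides, and equal parities leave the same power of \<open>rho\<close> outside the
  disk.\<close>

lemma on_axis_bracket:
  assumes "on_axis M D D'"
    and local: "\<And>k u s v u' s' v'. M k (u, s, v) (u', s', v') \<Longrightarrow>
      (\<forall>x\<in>set u \<union> set u'. k \<le> pos x) \<and> even (width s) = even (width s') \<and>
      (\<exists>m. tangle v (k + width s) m \<and> tangle v' (k + width s') m) \<and>
      (\<forall>f t. rho ^ (width s' div 2) * off u' (on k s' (off v' f)) t =
        \<kappa> * (rho ^ (width s div 2) * off u (on k s (off v f)) t))"
  shows "bracket D' = \<kappa> * bracket D"
  using assms(1)
proof cases
  case (1 lo u s v u' s' v' p hi q)
  from local[OF 1(3)] obtain m where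
    pos: "\<forall>x\<in>set u. width lo \<le> pos x" "\<forall>x\<in>set u'. width lo \<le> pos x" and
    parity: "even (width s) = even (width s')" and
    m: "tangle v (width lo + width s) m" "tangle v' (width lo + width s') m" and
    scale: "\<And>f t. rho ^ (width s' div 2) * off u' (on (width lo) s' (off v' f)) t =
        \<kappa> * (rho ^ (width s div 2) * off u (on (width lo) s (off v f)) t)"
    by blast
  let ?n = "width lo + width hi" and ?q = "off q (\<lambda>_. 1)"
  \<comment> \<open>As \<open>div 2\<close> is not additive, an odd strand of the disk is charged to
    the outside.\<close>
  have div: "width (lo @ x @ hi) div 2 = width x div 2 + (?n + width x mod 2) div 2" for x
    unfolding width_simps by presburger
  have sum: "state_sum (Word (p @ u) (lo @ s @ hi) (v @ q)) =
      rho ^ ((?n + width s mod 2) div 2) / deltaB *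
      off p (on 0 lo (\<lambda>t. rho ^ (width s div 2) * off u (on (width lo) s (off v (on m hi ?q))) t))
        (sconst False)"
    if "\<forall>x\<in>set u. width lo \<le> pos x" "tangle v (width lo + width s) m" for u s v
    unfolding state_sum_append div
    using that by (simp add: on_off_above on_off_below power_add run_scale axis_scale)
  have "width s' mod 2 = width s mod 2"
    using parity by presburger
  with 1 show ?thesis
    using pos m by (simp add: bracket_diag sum scale run_scale axis_scale del: state_sum.simps)
qed

text \<open>The loop of an S1 kink adds two strands on the axis, hence one \<open>rho\<close>, which
  turns \<open>deltaA\<close> into \<open>deltaB\<close>. The second computation then mirrors the
  first with B for A.\<close>

lemma kink_value:
  "off_weight c * deltaA + off_weight (opp c) = - (varA powi (3 * crossing_sign c))"
  "rho * (on_weight c * deltaA + on_weight_v c) = - (varB powi (3 * crossing_sign c))"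
proof -
  have rho: "rho * (on_weight c * deltaA + on_weight_v c) =
      on_weight c * deltaB + on_weight (opp c)"
    using rho_nonzero deltaA_nonzero by (simp add: on_weight_v_def rho_def field_simps)
  show "off_weight c * deltaA + off_weight (opp c) = - (varA powi (3 * crossing_sign c))"
    using varA_nonzero
    by (cases c) (simp_all add: deltaA_def crossing_sign_def power_int_minus field_simps
        power2_eq_square power3_eq_cube)
  show "rho * (on_weight c * deltaA + on_weight_v c) = - (varB powi (3 * crossing_sign c))"
    unfolding rho using varB_nonzero
    by (cases c) (simp_all add: deltaB_def crossing_sign_def power_int_minus field_simps
        power2_eq_square power3_eq_cube)
qed

lemma bracket_R1: "move_R1 e D' D \<Longrightarrow> bracket D = - (varA powi (3 * e)) * bracket D'"
  unfolding move_R1_def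
proof (erule off_axis_bracket)
  fix u u' f assume "local_R1 e u u'"
  then show "off u' f = (\<lambda>s. - (varA powi (3 * e)) * off u f s)"
    by cases (simp_all add: kink_up kink_down kink_value)
qed

lemma bracket_R2: "move_R2 D D' \<Longrightarrow> bracket D' = 1 * bracket D"
  unfolding move_R2_def
proof (erule off_axis_bracket)
  fix u u' f assume "local_R2 u u'"
  then show "off u' f = (\<lambda>s. 1 * off u f s)"
    by cases (simp add: R2_simps)
qed

lemma bracket_R3: "move_R3 D D' \<Longrightarrow> bracket D' = 1 * bracket D"
  unfolding move_R3_def
proof (erule off_axis_bracket)
  fix u u' f assume "local_R3 u u'"
  then show "off u' f = (\<lambda>s. 1 * off u f s)"
    by cases (simp add: R3)
qed

lemma bracket_S1: "move_S1 e D' D \<Longrightarrow> bracket D = - (varB powi (3 * e)) * bracket D'"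
  unfolding move_S1_def
proof (erule on_axis_bracket)
  fix k u s v u' s' v' assume "local_S1 e k (u, s, v) (u', s', v')"
  then show "(\<forall>x\<in>set u \<union> set u'. k \<le> pos x) \<and> even (width s) = even (width s') \<and>
      (\<exists>m. tangle v (k + width s) m \<and> tangle v' (k + width s') m) \<and>
      (\<forall>f t. rho ^ (width s' div 2) * off u' (on k s' (off v' f)) t =
        - (varB powi (3 * e)) * (rho ^ (width s div 2) * off u (on k s (off v f)) t))"
    by cases (simp_all add: kink_up kink_down after_def flip: kink_value)
qed

text \<open>\<open>rho * deltaA\<close> is \<open>deltaB\<close>, the negative of the sum of the two
  squares.\<close>

lemma rho_bubble:
  "rho * (rho * deltaA + on_weight c * on_weight c + on_weight (opp c) * on_weight (opp c)) = 0"
  using varB_nonzero deltaA_nonzero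
  by (cases c) (simp_all add: rho_def deltaB_def power2_eq_square)

text \<open>Of the four smoothings of two stacked crossings, two horizontal ones close a circle,
  mixed ones leave the identity, and two vertical ones leave a cap and a cup.\<close>

lemma (in temperley_lieb) bubble:
  "cup c (Suc i) (braid x y i (braid x' y' (i + 2) (cap d (Suc i) f))) =
    (\<lambda>t. (x * x' * \<delta> + x * y' + y * x') * f t + y * y' * cap d i (cup c i f) t)"
proof -
  have "cup c i (cap d (Suc (Suc i)) g) = cap d i (cup c i g)" for g
    using cup_cap_exchange[of i i] by simp
  then show ?thesis
    unfolding braid_def tl_simps by (simp add: tl_simps algebra_simps)
qed

text \<open>For opposite types the identity terms cancel by \<open>rho_bubble\<close>. In the
  surviving term the two factors \<open>1 / rho\<close> of the vertical weights absorb the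
  \<open>rho\<^sup>2\<close> of the four strands on the axis.\<close>

lemma axis_bubble:
  "rho\<^sup>2 * cup cup_weight (Suc k) (braid (on_weight c) (on_weight_v c) k
      (braid (on_weight (opp c)) (on_weight_v (opp c)) (k + 2) (cap cap_weight (Suc k) f))) t =
   cap cap_weight k (cup cup_weight k f) t"
proof -
  have w: "on_weight c * on_weight (opp c) = 1"
    using varB_nonzero by (cases c) auto
  have "rho\<^sup>2 * (on_weight c * on_weight (opp c) * deltaA + on_weight c * on_weight_v (opp c) +
      on_weight_v c * on_weight (opp c)) = 0"
    using rho_bubble[of c] rho_nonzero
    by (simp add: w on_weight_v_def power2_eq_square field_simps)
  moreover have "rho\<^sup>2 * (on_weight_v c * on_weight_v (opp c)) = 1"
    using w rho_nonzero by (simp add: on_weight_v_def power2_eq_square mult.commute)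
  ultimately show ?thesis
    unfolding bubble distrib_left mult.assoc[symmetric] by simp
qed

text \<open>Crossings of the same two strands are polynomials in one generator and commute, whatever
  their weights.\<close>

lemma (in kauffman) conjugate_same: "X e i (braid x y i (X (opp e) i f)) = braid x y i f"
proof -
  have "X e i (braid x y i g) = braid x y i (X e i g)" for g
    unfolding braid_def tl_simps by (simp add: algebra_simps)
  then show ?thesis by (simp add: R2_simps)
qed

lemma bracket_S2: "move_S2 D D' \<Longrightarrow> bracket D' = 1 * bracket D"
  unfolding move_S2_def
proof (elim disjE; erule on_axis_bracket)
  fix k u s v u' s' v' assume "local_S2v k (u, s, v) (u', s', v')"
  then show "(\<forall>x\<in>set u \<union> set u'. k \<le> pos x) \<and> even (width s) = even (width s') \<and>
      (\<exists>m. tangle v (k + width s) m \<and> tangle v' (k + width s') m) \<and>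
      (\<forall>f t. rho ^ (width s' div 2) * off u' (on k s' (off v' f)) t =
        1 * (rho ^ (width s div 2) * off u (on k s (off v f)) t))"
    by cases (simp add: after_def axis_bubble[simplified])
next
  fix k u s v u' s' v' assume "local_S2h k (u, s, v) (u', s', v')"
  then show "(\<forall>x\<in>set u \<union> set u'. k \<le> pos x) \<and> even (width s) = even (width s') \<and>
      (\<exists>m. tangle v (k + width s) m \<and> tangle v' (k + width s') m) \<and>
      (\<forall>f t. rho ^ (width s' div 2) * off u' (on k s' (off v' f)) t =
        1 * (rho ^ (width s div 2) * off u (on k s (off v f)) t))"
    by cases (simp add: after_def R2_simps)
next
  fix k u s v u' s' v' assume "local_S2pm k (u, s, v) (u', s', v')"
  then show "(\<forall>x\<in>set u \<union> set u'. k \<le> pos x) \<and> even (width s) = even (width s') \<and>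
      (\<exists>m. tangle v (k + width s) m \<and> tangle v' (k + width s') m) \<and>
      (\<forall>f t. rho ^ (width s' div 2) * off u' (on k s' (off v' f)) t =
        1 * (rho ^ (width s div 2) * off u (on k s (off v f)) t))"
    by cases (simp add: after_def conjugate_same[simplified opp_opp])
qed

lemma bracket_S3: "move_S3 D D' \<Longrightarrow> bracket D' = 1 * bracket D"
  unfolding move_S3_def
proof (erule on_axis_bracket)
  fix k u s v u' s' v' assume "local_S3 k (u, s, v) (u', s', v')"
  then show "(\<forall>x\<in>set u \<union> set u'. k \<le> pos x) \<and> even (width s) = even (width s') \<and>
      (\<exists>m. tangle v (k + width s) m \<and> tangle v' (k + width s') m) \<and>
      (\<forall>f t. rho ^ (width s' div 2) * off u' (on k s' (off v' f)) t =
        1 * (rho ^ (width s div 2) * off u (on k s (off v f)) t))"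
    by cases (simp add: after_def conjugate_slide[simplified opp_opp])
qed

lemma bracket_S4: "move_S4 D D' \<Longrightarrow> bracket D' = 1 * bracket D"
  unfolding move_S4_def
proof (erule on_axis_bracket)
  fix k u s v u' s' v' assume "local_S4 k (u, s, v) (u', s', v')"
  then show "(\<forall>x\<in>set u \<union> set u'. k \<le> pos x) \<and> even (width s) = even (width s') \<and>
      (\<exists>m. tangle v (k + width s) m \<and> tangle v' (k + width s') m) \<and>
      (\<forall>f t. rho ^ (width s' div 2) * off u' (on k s' (off v' f)) t =
        1 * (rho ^ (width s div 2) * off u (on k s (off v f)) t))"
  proof cases
    case (over_steep t' s'')
    then show ?thesis
      using double_slide[of Xu k] by (simp add: after_def)
  next
    case (under_steep t' s'')
    then show ?thesis
      using double_slide[of Xo k] by (simp add: after_def)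
  qed
qed

theorem lemma1p3:
  fixes D D' :: diagram and e :: int
  shows "(move_R2 D D' \<longrightarrow> bracket D = bracket D') \<and>
         (move_R3 D D' \<longrightarrow> bracket D = bracket D') \<and>
         (move_S2 D D' \<longrightarrow> bracket D = bracket D') \<and>
         (move_S3 D D' \<longrightarrow> bracket D = bracket D') \<and>
         (move_S4 D D' \<longrightarrow> bracket D = bracket D') \<and>
         (move_R1 e D' D \<longrightarrow> bracket D = - (varA powi (3 * e)) * bracket D') \<and>
         (move_S1 e D' D \<longrightarrow> bracket D = - (varB powi (3 * e)) * bracket D')"
  using bracket_R1 bracket_R2 bracket_R3 bracket_S1 bracket_S2 bracket_S3 bracket_S4 by auto

end
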